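(* Let $\mathfrak g=5A_1$ be the $5$-dimensional abelian real Lie algebra and let $G$ be a connected Lie group with Lie algebra $\mathfrak g$. Let $T$ be a left-invariant symmetric tensor field of type $(0,2)$ on $G$. There exists a pair $(g,t)$, where $g$ is a left-invariant Riemannian metric on $G$ and $t$ is a non-zero real constant, such that $\mathrm{Ric}(g)=t^2T$, if and only if $T=0$.
   Context: $\mathrm{Ric}(g)$ denotes the Ricci curvature of $g$, viewed as a left-invariant symmetric $(0,2)$-tensor field. $5A_1$ is the $5$-dimensional real Lie algebra with all brackets zero. *)

theory Defs
  imports "HOL-Analysis.Analysis"
begin

section \<open>Smooth maps between normed spaces\<close>

text \<open>
  Intended for open subsets \<open>S\<close> of finite-dimensional spaces, where \<open>k_smooth_on k S f\<close> says that
  \<open>f\<close> is of class \<open>C\<^sup>k\<close> on \<open>S\<close>: all iterated directional derivatives up to order \<open>k\<close>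
  exist and are continuous.
\<close>

primrec k_smooth_on ::
  "nat \<Rightarrow> 'a::real_normed_vector set \<Rightarrow> ('a \<Rightarrow> 'b::real_normed_vector) \<Rightarrow> bool" where
  "k_smooth_on 0 S f \<longleftrightarrow> continuous_on S f"
| "k_smooth_on (Suc k) S f \<longleftrightarrow>
     (\<forall>x\<in>S. f differentiable (at x)) \<and>
     (\<forall>v. k_smooth_on k S (\<lambda>x. frechet_derivative f (at x) v))"

definition smooth_on :: "'a::real_normed_vector set \<Rightarrow> ('a \<Rightarrow> 'b::real_normed_vector) \<Rightarrow> bool" where
  "smooth_on S f \<longleftrightarrow> (\<forall>k. k_smooth_on k S f)"


section \<open>Smooth manifolds\<close>

text \<open>A chart is a domain together with a coordinate map; only the values on the domain matter.\<close>

type_synonym ('g, 'e) chart = "'g set \<times> ('g \<Rightarrow> 'e)"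

definition chart_inv :: "('g, 'e) chart \<Rightarrow> 'e \<Rightarrow> 'g" where
  "chart_inv c = inv_into (fst c) (snd c)"

definition chart_image :: "('g, 'e) chart \<Rightarrow> 'e set" where
  "chart_image c = snd c ` fst c"

definition is_chart :: "('g::topological_space, 'e::euclidean_space) chart \<Rightarrow> bool" where
  "is_chart c \<longleftrightarrow> open (fst c) \<and> open (chart_image c) \<and>
     homeomorphism (fst c) (chart_image c) (snd c) (chart_inv c)"

text \<open>
  The manifold is the whole type \<open>'g\<close>, modelled on the Euclidean space \<open>'e\<close>. The atlas is not
  required to be maximal.
\<close>

definition smooth_atlas :: "('g::topological_space, 'e::euclidean_space) chart set \<Rightarrow> bool" where
  "smooth_atlas A \<longleftrightarrow>
     (\<forall>c\<in>A. is_chart c) \<and>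
     (\<Union>c\<in>A. fst c) = UNIV \<and>
     (\<forall>c\<in>A. \<forall>d\<in>A. smooth_on (snd c ` (fst c \<inter> fst d)) (snd d \<circ> chart_inv c))"

definition smooth_fun_on ::
  "('g::topological_space, 'e::euclidean_space) chart set \<Rightarrow> 'g set \<Rightarrow> ('g \<Rightarrow> real) \<Rightarrow> bool" where
  "smooth_fun_on A W f \<longleftrightarrow>
     open W \<and> (\<forall>c\<in>A. smooth_on (snd c ` (fst c \<inter> W)) (f \<circ> chart_inv c))"

definition smooth_near ::
  "('g::topological_space, 'e::euclidean_space) chart set \<Rightarrow> 'g \<Rightarrow> ('g \<Rightarrow> real) \<Rightarrow> bool" where
  "smooth_near A p f \<longleftrightarrow> (\<exists>W. p \<in> W \<and> smooth_fun_on A W f)"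


section \<open>Lie groups\<close>

text \<open>
  The group operation is written additively because the library's class of topological groups is;
  \<^class>\<open>topological_group_add\<close> does not assume commutativity. Continuity of the operations
  comes from the class and makes the sets below open.
\<close>

definition lie_group ::
  "('g::{topological_group_add, t2_space, second_countable_topology}, 'e::euclidean_space) chart set
     \<Rightarrow> bool" where
  "lie_group A \<longleftrightarrow>
     smooth_atlas A \<and>
     (\<forall>c\<in>A. \<forall>d\<in>A. \<forall>e\<in>A.
        smooth_on
          {(x, y). x \<in> chart_image c \<and> y \<in> chart_image d \<and> chart_inv c x + chart_inv d y \<in> fst e}
          (\<lambda>(x, y). snd e (chart_inv c x + chart_inv d y))) \<and>
     (\<forall>c\<in>A. \<forall>d\<in>A.
        smooth_on {x. x \<in> chart_image c \<and> - chart_inv c x \<in> fst d}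
          (\<lambda>x. snd d (- chart_inv c x)))"


section \<open>Tangent vectors and vector fields\<close>

text \<open>
  A tangent vector at \<open>p\<close> is the velocity of a smooth curve through \<open>p\<close>, regarded as an operator
  on the functions that are smooth near \<open>p\<close>. It takes the value 0 on all other functions, so that
  two tangent vectors (and two vector fields) are equal as soon as they agree on smooth functions.
\<close>

type_synonym 'g tangent_vector = "('g \<Rightarrow> real) \<Rightarrow> real"
type_synonym 'g vector_field = "'g \<Rightarrow> 'g tangent_vector"
type_synonym 'g tensor2 = "'g \<Rightarrow> 'g tangent_vector \<Rightarrow> 'g tangent_vector \<Rightarrow> real"

definition smooth_curve ::
  "('g::topological_space, 'e::euclidean_space) chart set \<Rightarrow> real \<Rightarrow> (real \<Rightarrow> 'g) \<Rightarrow> bool" where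
  "smooth_curve A \<epsilon> \<gamma> \<longleftrightarrow>
     \<epsilon> > 0 \<and> continuous_on {-\<epsilon><..<\<epsilon>} \<gamma> \<and>
     (\<forall>c\<in>A. smooth_on {t. -\<epsilon> < t \<and> t < \<epsilon> \<and> \<gamma> t \<in> fst c} (snd c \<circ> \<gamma>))"

definition velocity ::
  "('g::topological_space, 'e::euclidean_space) chart set \<Rightarrow> (real \<Rightarrow> 'g) \<Rightarrow> 'g tangent_vector" where
  "velocity A \<gamma> = (\<lambda>f. if smooth_near A (\<gamma> 0) f then deriv (f \<circ> \<gamma>) 0 else 0)"

definition tangent_space ::
  "('g::topological_space, 'e::euclidean_space) chart set \<Rightarrow> 'g \<Rightarrow> 'g tangent_vector set" where
  "tangent_space A p = {velocity A \<gamma> | \<gamma> \<epsilon>. smooth_curve A \<epsilon> \<gamma> \<and> \<gamma> 0 = p}"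

definition smooth_vector_field ::
  "('g::topological_space, 'e::euclidean_space) chart set \<Rightarrow> 'g vector_field \<Rightarrow> bool" where
  "smooth_vector_field A X \<longleftrightarrow>
     (\<forall>p. X p \<in> tangent_space A p) \<and>
     (\<forall>W f. smooth_fun_on A W f \<longrightarrow> smooth_fun_on A W (\<lambda>p. X p f))"

definition field_add :: "'g vector_field \<Rightarrow> 'g vector_field \<Rightarrow> 'g vector_field" where
  "field_add X Y = (\<lambda>p f. X p f + Y p f)"

definition field_mult :: "('g \<Rightarrow> real) \<Rightarrow> 'g vector_field \<Rightarrow> 'g vector_field" where
  "field_mult h X = (\<lambda>p f. h p * X p f)"

definition field_diff :: "'g vector_field \<Rightarrow> 'g vector_field \<Rightarrow> 'g vector_field" where
  "field_diff X Y = (\<lambda>p f. X p f - Y p f)"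

definition field_bracket ::
  "('g::topological_space, 'e::euclidean_space) chart set \<Rightarrow>
     'g vector_field \<Rightarrow> 'g vector_field \<Rightarrow> 'g vector_field" where
  "field_bracket A X Y = (\<lambda>p f.
     if smooth_near A p f then X p (\<lambda>q. Y q f) - Y p (\<lambda>q. X q f) else 0)"


section \<open>The Lie algebra of a Lie group\<close>

text \<open>The differential of the left translation by \<open>a\<close>.\<close>

definition left_push :: "'g::plus \<Rightarrow> 'g tangent_vector \<Rightarrow> 'g tangent_vector" where
  "left_push a v = (\<lambda>f. v (\<lambda>x. f (a + x)))"

definition left_invariant_fields ::
  "('g::{plus, topological_space}, 'e::euclidean_space) chart set \<Rightarrow> 'g vector_field set" where
  "left_invariant_fields A =
     {X. smooth_vector_field A X \<and> (\<forall>a p. X (a + p) = left_push a (X p))}"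

definition has_lie_algebra ::
  "('g::{plus, topological_space}, 'e::euclidean_space) chart set \<Rightarrow>
     ('v::real_vector \<Rightarrow> 'v \<Rightarrow> 'v) \<Rightarrow> bool" where
  "has_lie_algebra A br \<longleftrightarrow>
     (\<exists>\<Phi>. bij_betw \<Phi> (left_invariant_fields A) UNIV \<and>
        (\<forall>X\<in>left_invariant_fields A. \<forall>Y\<in>left_invariant_fields A.
           \<Phi> (field_add X Y) = \<Phi> X + \<Phi> Y \<and>
           \<Phi> (field_bracket A X Y) = br (\<Phi> X) (\<Phi> Y)) \<and>
        (\<forall>X\<in>left_invariant_fields A. \<forall>r. \<Phi> (field_mult (\<lambda>_. r) X) = r *\<^sub>R \<Phi> X))"

definition bracket_5A1 :: "real^5 \<Rightarrow> real^5 \<Rightarrow> real^5" where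
  "bracket_5A1 x y = 0"


section \<open>Tensor fields of type (0,2) and Riemannian metrics\<close>

text \<open>The values of a tensor field outside the tangent spaces are irrelevant junk.\<close>

definition tensor_field2 ::
  "('g::topological_space, 'e::euclidean_space) chart set \<Rightarrow> 'g tensor2 \<Rightarrow> bool" where
  "tensor_field2 A T \<longleftrightarrow>
     (\<forall>p. \<forall>u\<in>tangent_space A p. \<forall>v\<in>tangent_space A p. \<forall>w\<in>tangent_space A p. \<forall>r s.
        T p (\<lambda>f. r * u f + s * v f) w = r * T p u w + s * T p v w \<and>
        T p w (\<lambda>f. r * u f + s * v f) = r * T p w u + s * T p w v) \<and>
     (\<forall>X Y. smooth_vector_field A X \<longrightarrow> smooth_vector_field A Y \<longrightarrow>
        smooth_fun_on A UNIV (\<lambda>p. T p (X p) (Y p)))"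

definition symmetric_tensor_field2 ::
  "('g::topological_space, 'e::euclidean_space) chart set \<Rightarrow> 'g tensor2 \<Rightarrow> bool" where
  "symmetric_tensor_field2 A T \<longleftrightarrow> tensor_field2 A T \<and>
     (\<forall>p. \<forall>u\<in>tangent_space A p. \<forall>v\<in>tangent_space A p. T p u v = T p v u)"

definition left_invariant2 ::
  "('g::{plus, topological_space}, 'e::euclidean_space) chart set \<Rightarrow> 'g tensor2 \<Rightarrow> bool" where
  "left_invariant2 A T \<longleftrightarrow>
     (\<forall>a p. \<forall>u\<in>tangent_space A p. \<forall>v\<in>tangent_space A p.
        T (a + p) (left_push a u) (left_push a v) = T p u v)"

definition riemannian_metric ::
  "('g::topological_space, 'e::euclidean_space) chart set \<Rightarrow> 'g tensor2 \<Rightarrow> bool" where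
  "riemannian_metric A g \<longleftrightarrow> symmetric_tensor_field2 A g \<and>
     (\<forall>p. \<forall>u\<in>tangent_space A p. u \<noteq> (\<lambda>_. 0) \<longrightarrow> g p u u > 0)"


section \<open>Levi-Civita connection and Ricci curvature\<close>

type_synonym 'g connection = "'g vector_field \<Rightarrow> 'g vector_field \<Rightarrow> 'g vector_field"

definition affine_connection ::
  "('g::topological_space, 'e::euclidean_space) chart set \<Rightarrow> 'g connection \<Rightarrow> bool" where
  "affine_connection A D \<longleftrightarrow>
     (\<forall>X Y. smooth_vector_field A X \<longrightarrow> smooth_vector_field A Y \<longrightarrow>
        smooth_vector_field A (D X Y)) \<and>
     (\<forall>X Y Z. smooth_vector_field A X \<longrightarrow> smooth_vector_field A Y \<longrightarrow> smooth_vector_field A Z \<longrightarrow>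
        D (field_add X Y) Z = field_add (D X Z) (D Y Z) \<and>
        D X (field_add Y Z) = field_add (D X Y) (D X Z)) \<and>
     (\<forall>h X Y. smooth_fun_on A UNIV h \<longrightarrow> smooth_vector_field A X \<longrightarrow> smooth_vector_field A Y \<longrightarrow>
        D (field_mult h X) Y = field_mult h (D X Y) \<and>
        D X (field_mult h Y) = field_add (field_mult (\<lambda>p. X p h) Y) (field_mult h (D X Y)))"

definition is_levi_civita ::
  "('g::topological_space, 'e::euclidean_space) chart set \<Rightarrow> 'g tensor2 \<Rightarrow> 'g connection \<Rightarrow> bool" where
  "is_levi_civita A g D \<longleftrightarrow> affine_connection A D \<and>
     (\<forall>X Y. smooth_vector_field A X \<longrightarrow> smooth_vector_field A Y \<longrightarrow>
        field_diff (D X Y) (D Y X) = field_bracket A X Y) \<and>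
     (\<forall>X Y Z. smooth_vector_field A X \<longrightarrow> smooth_vector_field A Y \<longrightarrow> smooth_vector_field A Z \<longrightarrow>
        (\<forall>p. X p (\<lambda>q. g q (Y q) (Z q)) = g p (D X Y p) (Z p) + g p (Y p) (D X Z p)))"

text \<open>
  The choice operator is used rather than a definite description only because the conditions say
  nothing about arguments that are not smooth vector fields; on smooth vector fields the
  connection is unique.
\<close>

definition levi_civita ::
  "('g::topological_space, 'e::euclidean_space) chart set \<Rightarrow> 'g tensor2 \<Rightarrow> 'g connection" where
  "levi_civita A g = (SOME D. is_levi_civita A g D)"

definition curvature ::
  "('g::topological_space, 'e::euclidean_space) chart set \<Rightarrow> 'g connection \<Rightarrow>
     'g vector_field \<Rightarrow> 'g vector_field \<Rightarrow> 'g vector_field \<Rightarrow> 'g vector_field" where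
  "curvature A D X Y Z =
     field_diff (field_diff (D X (D Y Z)) (D Y (D X Z))) (D (field_bracket A X Y) Z)"

text \<open>
  The value of \<open>curvature A D X Y Z\<close> at \<open>p\<close> depends only on the values of \<open>X\<close>, \<open>Y\<close>, \<open>Z\<close> at \<open>p\<close>,
  so it may be computed on tangent vectors by means of arbitrary extensions to vector fields.
\<close>

definition extend_vector ::
  "('g::topological_space, 'e::euclidean_space) chart set \<Rightarrow>
     'g \<Rightarrow> 'g tangent_vector \<Rightarrow> 'g vector_field" where
  "extend_vector A p u = (SOME X. smooth_vector_field A X \<and> X p = u)"

definition curvature_at ::
  "('g::topological_space, 'e::euclidean_space) chart set \<Rightarrow> 'g tensor2 \<Rightarrow> 'g \<Rightarrow>
     'g tangent_vector \<Rightarrow> 'g tangent_vector \<Rightarrow> 'g tangent_vector \<Rightarrow> 'g tangent_vector" where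
  "curvature_at A g p u v w =
     curvature A (levi_civita A g)
       (extend_vector A p u) (extend_vector A p v) (extend_vector A p w) p"

definition orthonormal_basis ::
  "('g::topological_space, 'e::euclidean_space) chart set \<Rightarrow> 'g tensor2 \<Rightarrow> 'g \<Rightarrow>
     'g tangent_vector set \<Rightarrow> bool" where
  "orthonormal_basis A g p B \<longleftrightarrow>
     finite B \<and> B \<subseteq> tangent_space A p \<and>
     (\<forall>b\<in>B. \<forall>b'\<in>B. g p b b' = (if b = b' then 1 else 0)) \<and>
     (\<forall>u\<in>tangent_space A p. u = (\<lambda>f. \<Sum>b\<in>B. g p u b * b f))"

text \<open>\<open>Ric(u, v)\<close> is the trace of \<open>w \<mapsto> R(w, u)v\<close>.\<close>

definition ricci ::
  "('g::topological_space, 'e::euclidean_space) chart set \<Rightarrow> 'g tensor2 \<Rightarrow> 'g tensor2" where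
  "ricci A g p u v =
     (\<Sum>b\<in>(SOME B. orthonormal_basis A g p B). g p (curvature_at A g p b u v) b)"

end

theory Submission
  imports Defs
begin

text \<open>
  The theorem holds because every left-invariant metric \<open>g\<close> on \<open>G\<close> is flat. Then
  \<open>Ric(g) = t\<^sup>2 T\<close> with \<open>t \<noteq> 0\<close> says \<open>T = 0\<close>, and for \<open>T = 0\<close> any left-invariant metric solves
  the equation.

  Flatness comes from a global frame. An orthonormal basis of the tangent space at the neutral
  element extends to left-invariant fields \<open>E\<^sub>b\<close>, which are orthonormal everywhere
  (\<open>orthonormal_frame_exists\<close>). They commute: the bracket of two left-invariant fields is again
  left-invariant, and the isomorphism with the abelian Lie algebra sends it to 0
  (\<open>field_bracket_left_invariant_eq_0\<close>). The connection \<open>D X Y = \<Sum>\<^sub>b X(g(Y, E\<^sub>b)) E\<^sub>b\<close>, for which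
  the frame is parallel, preserves \<open>g\<close>, and its torsion vanishes because the frame commutes. It is
  therefore the Levi-Civita connection (\<open>levi_civita_unique\<close>, \<open>levi_civita_eq\<close>). As it
  differentiates components, \<open>R(X, Y) Z\<close> has the components \<open>X(Y z) - Y(X z) - [X, Y] z = 0\<close>
  (\<open>curvature_zero\<close>).

  A left-invariant metric exists because any inner product at the neutral element can be
  transported by left translations; here it is the Euclidean one in a chart
  (\<open>left_invariant_metric_exists\<close>).

  The analytic part justifies these manipulations for tangent vectors given as velocities of
  curves. In a chart a tangent vector is a directional derivative (\<open>tangent_space_eq\<close>), and hence
  obeys the Leibniz rule. The operator \<open>[X, Y]\<close> is of first order, and so is itself a vector field,
  by the symmetry of second derivatives (\<open>FD_FD_commute\<close>, \<open>field_bracket_in_chart\<close>).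
\<close>

section \<open>Calculus of smooth maps\<close>

abbreviation FD :: "('a::real_normed_vector \<Rightarrow> 'b::real_normed_vector) \<Rightarrow> 'a \<Rightarrow> 'a \<Rightarrow> 'b"
  where "FD f x \<equiv> frechet_derivative f (at x)"

lemma FD_works: "f differentiable (at x) \<Longrightarrow> (f has_derivative FD f x) (at x)"
  by (simp add: frechet_derivative_works)

lemma FD_eq: "(f has_derivative f') (at x) \<Longrightarrow> FD f x = f'"
  using frechet_derivative_at by metis

lemma FD_linear: "f differentiable (at x) \<Longrightarrow> linear (FD f x)"
  by (rule linear_frechet_derivative)

lemma differentiable_cong_open:
  assumes "open S" "x \<in> S" "\<And>y. y \<in> S \<Longrightarrow> f y = g y" "f differentiable (at x)"
  shows "g differentiable (at x)"
  using assms has_derivative_transform_within_open unfolding differentiable_def by metis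

lemma k_smooth_on_subset: "k_smooth_on k S f \<Longrightarrow> T \<subseteq> S \<Longrightarrow> k_smooth_on k T f"
  by (induction k arbitrary: f) (auto intro: continuous_on_subset)

lemma k_smooth_on_cong:
  assumes "open S" "\<And>x. x \<in> S \<Longrightarrow> f x = g x" "k_smooth_on k S f"
  shows "k_smooth_on k S g"
  using assms(2,3)
proof (induction k arbitrary: f g)
  case 0
  then show ?case by (simp cong: continuous_on_cong)
next
  case (Suc k)
  have "k_smooth_on k S (\<lambda>x. FD g x v)" for v
  proof (rule Suc.IH)
    show "k_smooth_on k S (\<lambda>x. FD f x v)" using Suc.prems by simp
    show "FD f x v = FD g x v" if "x \<in> S" for x
      using frechet_derivative_transform_within_open[of f x S g] that Suc.prems assms(1) by auto
  qed
  moreover have "g differentiable (at x)" if "x \<in> S" for x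
    using differentiable_cong_open[of S x f g] that Suc.prems assms(1) by auto
  ultimately show ?case by simp
qed

lemma k_smooth_on_lower: "k_smooth_on (Suc k) S f \<Longrightarrow> k_smooth_on k S f"
proof (induction k arbitrary: f)
  case 0
  then show ?case
    by (auto intro!: continuous_at_imp_continuous_on differentiable_imp_continuous_within)
next
  case (Suc k)
  from Suc.prems have d: "\<forall>x\<in>S. f differentiable (at x)"
    and s: "\<And>v. k_smooth_on (Suc k) S (\<lambda>x. FD f x v)"
    unfolding k_smooth_on.simps(2)[of "Suc k"] by blast+
  from s have "k_smooth_on k S (\<lambda>x. FD f x v)" for v using Suc.IH by blast
  with d show ?case by simp
qed

lemma k_smooth_on_const: "k_smooth_on k S (\<lambda>x. c)"
  by (induction k arbitrary: c) simp_all

lemma k_smooth_on_bounded_linear: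
  assumes "bounded_linear f" shows "k_smooth_on k S f"
proof (cases k)
  case 0
  then show ?thesis using assms by (simp add: linear_continuous_on)
next
  case (Suc m)
  have "FD f x = f" for x using assms by (intro FD_eq bounded_linear_imp_has_derivative)
  then show ?thesis using Suc assms
    by (auto simp: k_smooth_on_const bounded_linear_imp_differentiable)
qed

lemma k_smooth_on_add:
  assumes "open S" "k_smooth_on k S f" "k_smooth_on k S g"
  shows "k_smooth_on k S (\<lambda>x. f x + g x)"
  using assms(2,3)
proof (induction k arbitrary: f g)
  case 0
  then show ?case by (simp add: continuous_on_add)
next
  case (Suc k)
  have fd: "f differentiable (at x)" "g differentiable (at x)" if "x \<in> S" for x
    using Suc.prems that by auto
  have eq: "FD f x v + FD g x v = FD (\<lambda>x. f x + g x) x v" if "x \<in> S" for x v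
    using FD_eq[OF has_derivative_add[OF FD_works FD_works], OF fd[OF that]] by simp
  have "k_smooth_on k S (\<lambda>x. FD (\<lambda>x. f x + g x) x v)" for v
    by (rule k_smooth_on_cong[OF assms(1) eq Suc.IH]) (use Suc.prems in auto)
  then show ?case using fd by simp
qed

lemma k_smooth_on_bilinear:
  assumes "bounded_bilinear B" "open S" "k_smooth_on k S f" "k_smooth_on k S g"
  shows "k_smooth_on k S (\<lambda>x. B (f x) (g x))"
  using assms(3,4)
proof (induction k arbitrary: f g)
  case 0
  then show ?case using assms(1) by (simp add: bounded_bilinear.continuous_on)
next
  case (Suc k)
  have fd: "f differentiable (at x)" "g differentiable (at x)" if "x \<in> S" for x
    using Suc.prems that by auto
  have d: "((\<lambda>x. B (f x) (g x)) has_derivative (\<lambda>h. B (f x) (FD g x h) + B (FD f x h) (g x))) (at x)"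
    if "x \<in> S" for x
    using bounded_bilinear.FDERIV[OF assms(1) FD_works FD_works] fd[OF that] by blast
  have eq: "B (f x) (FD g x v) + B (FD f x v) (g x) = FD (\<lambda>x. B (f x) (g x)) x v" if "x \<in> S" for x v
    using FD_eq[OF d[OF that]] by simp
  have "k_smooth_on k S (\<lambda>x. FD (\<lambda>x. B (f x) (g x)) x v)" for v
    by (rule k_smooth_on_cong[OF assms(2) eq k_smooth_on_add[OF assms(2) Suc.IH Suc.IH]])
      (use Suc.prems k_smooth_on_lower in auto)
  then show ?case using d by (auto simp: differentiable_def)
qed

lemma k_smooth_on_linear_comp:
  assumes "bounded_linear L" "open S" "k_smooth_on k S f"
  shows "k_smooth_on k S (\<lambda>x. L (f x))"
  using assms(3)
proof (induction k arbitrary: f)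
  case 0
  then show ?case using assms(1) by (simp add: bounded_linear.continuous_on)
next
  case (Suc k)
  have d: "((\<lambda>x. L (f x)) has_derivative (\<lambda>h. L (FD f x h))) (at x)" if "x \<in> S" for x
    using bounded_linear.has_derivative[OF assms(1) FD_works] Suc.prems that by auto
  have eq: "L (FD f x v) = FD (\<lambda>x. L (f x)) x v" if "x \<in> S" for x v
    using FD_eq[OF d[OF that]] by simp
  have "k_smooth_on k S (\<lambda>x. FD (\<lambda>x. L (f x)) x v)" for v
    by (rule k_smooth_on_cong[OF assms(2) eq Suc.IH]) (use Suc.prems in auto)
  then show ?case using d by (auto simp: differentiable_def)
qed

lemma k_smooth_on_sum:
  assumes "open S" "\<And>i. i \<in> I \<Longrightarrow> k_smooth_on k S (f i)"
  shows "k_smooth_on k S (\<lambda>x. \<Sum>i\<in>I. f i x)"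
  using assms(2)
  by (induction I rule: infinite_finite_induct)
    (auto simp: k_smooth_on_const intro!: k_smooth_on_add[OF assms(1)])

lemma k_smooth_on_Pair:
  assumes "open S" "k_smooth_on k S f" "k_smooth_on k S g"
  shows "k_smooth_on k S (\<lambda>x. (f x, g x))"
proof -
  have "k_smooth_on k S (\<lambda>x. (f x, 0) + (0, g x))"
    by (intro k_smooth_on_add assms(1) k_smooth_on_linear_comp[OF _ assms(1,2)]
        k_smooth_on_linear_comp[OF _ assms(1,3)])
      (auto intro!: bounded_linear_intros bounded_linear_Pair)
  then show ?thesis by simp
qed

text \<open>
  Smoothness is defined through derivatives in fixed directions, whereas the chain rule produces
  derivatives in directions that vary with the point. Expanding the direction in a basis reduces
  the second kind to the first.
\<close>

lemma linear_expand_Basis: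
  fixes w :: "'a::euclidean_space"
  assumes "linear L"
  shows "L w = (\<Sum>b\<in>Basis. (w \<bullet> b) *\<^sub>R L b)"
proof -
  have "L w = L (\<Sum>b\<in>Basis. (w \<bullet> b) *\<^sub>R b)" by (simp add: euclidean_representation)
  also have "\<dots> = (\<Sum>b\<in>Basis. (w \<bullet> b) *\<^sub>R L b)"
    using assms by (simp add: linear_sum linear_cmul)
  finally show ?thesis .
qed

lemma k_smooth_on_compose:
  fixes f :: "'b::euclidean_space \<Rightarrow> 'c::real_normed_vector"
  assumes "open S" "open T" "g ` S \<subseteq> T" "k_smooth_on k T f" "k_smooth_on k S g"
  shows "k_smooth_on k S (f \<circ> g)"
  using assms(4,5)
proof (induction k arbitrary: f)
  case 0
  then show ?case
    using assms(3) continuous_on_compose[of S g f] continuous_on_subset[of T f "g ` S"] by simp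
next
  case (Suc k)
  have gd: "g differentiable (at x)" if "x \<in> S" for x using Suc.prems that by auto
  have fd: "f differentiable (at (g x))" if "x \<in> S" for x using Suc.prems that assms(3) by auto
  have eq: "(\<Sum>b\<in>Basis. (FD g x v \<bullet> b) *\<^sub>R ((\<lambda>y. FD f y b) \<circ> g) x) = FD (f \<circ> g) x v"
    if "x \<in> S" for x v
    unfolding frechet_derivative_compose[OF gd[OF that] fd[OF that]] o_apply
    by (rule linear_expand_Basis[OF FD_linear[OF fd[OF that]], symmetric])
  have "k_smooth_on k S (\<lambda>x. FD (f \<circ> g) x v)" for v
    by (rule k_smooth_on_cong[OF assms(1) eq], assumption,
      intro k_smooth_on_sum k_smooth_on_bilinear[OF bounded_bilinear_scaleR] assms(1)
        k_smooth_on_linear_comp[OF bounded_linear_inner_left] Suc.IH)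
      (use Suc.prems k_smooth_on_lower in auto)
  moreover have "(f \<circ> g) differentiable (at x)" if "x \<in> S" for x
    using differentiable_chain_at gd fd that by blast
  ultimately show ?case unfolding k_smooth_on.simps by blast
qed

lemma k_smooth_on_local:
  assumes "\<And>x. x \<in> S \<Longrightarrow> \<exists>U. open U \<and> x \<in> U \<and> k_smooth_on k U f"
  shows "k_smooth_on k S f"
  using assms
proof (induction k arbitrary: f)
  case 0
  then have "continuous (at x) f" if "x \<in> S" for x
    using that continuous_on_eq_continuous_at by (metis k_smooth_on.simps(1))
  then show ?case by (simp add: continuous_at_imp_continuous_on)
next
  case (Suc k)
  have "f differentiable (at x)" if "x \<in> S" for x using Suc.prems[OF that] by auto
  moreover have "k_smooth_on k S (\<lambda>x. FD f x v)" for v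
    by (rule Suc.IH) (use Suc.prems in force)
  ultimately show ?case by simp
qed



lemma smooth_on_differentiable: "smooth_on S f \<Longrightarrow> x \<in> S \<Longrightarrow> f differentiable (at x)"
  unfolding smooth_on_def by (metis k_smooth_on.simps(2))

lemma smooth_on_FD: "smooth_on S f \<Longrightarrow> smooth_on S (\<lambda>x. FD f x v)"
  unfolding smooth_on_def by (metis k_smooth_on.simps(2))

lemma smooth_on_continuous: "smooth_on S f \<Longrightarrow> continuous_on S f"
  unfolding smooth_on_def by (metis k_smooth_on.simps(1))

lemma smooth_on_subset: "smooth_on S f \<Longrightarrow> T \<subseteq> S \<Longrightarrow> smooth_on T f"
  unfolding smooth_on_def using k_smooth_on_subset by blast

lemma smooth_on_cong:
  "smooth_on S f \<Longrightarrow> open S \<Longrightarrow> (\<And>x. x \<in> S \<Longrightarrow> f x = g x) \<Longrightarrow> smooth_on S g"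
  unfolding smooth_on_def using k_smooth_on_cong by metis

lemma smooth_on_local:
  "(\<And>x. x \<in> S \<Longrightarrow> \<exists>U. open U \<and> x \<in> U \<and> smooth_on U f) \<Longrightarrow> smooth_on S f"
  unfolding smooth_on_def by (meson k_smooth_on_local)

lemma smooth_on_const: "smooth_on S (\<lambda>x. c)"
  by (simp add: smooth_on_def k_smooth_on_const)

lemma smooth_on_bounded_linear: "bounded_linear f \<Longrightarrow> smooth_on S f"
  by (simp add: smooth_on_def k_smooth_on_bounded_linear)

lemma smooth_on_ident: "smooth_on S (\<lambda>x. x)"
  by (rule smooth_on_bounded_linear) (rule bounded_linear_ident)

lemma smooth_on_add:
  "open S \<Longrightarrow> smooth_on S f \<Longrightarrow> smooth_on S g \<Longrightarrow> smooth_on S (\<lambda>x. f x + g x)"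
  by (simp add: smooth_on_def k_smooth_on_add)

lemma smooth_on_bilinear:
  "bounded_bilinear B \<Longrightarrow> open S \<Longrightarrow> smooth_on S f \<Longrightarrow> smooth_on S g \<Longrightarrow>
    smooth_on S (\<lambda>x. B (f x) (g x))"
  by (simp add: smooth_on_def k_smooth_on_bilinear)

lemmas smooth_on_mult = smooth_on_bilinear[OF bounded_bilinear_mult]
lemmas smooth_on_scaleR = smooth_on_bilinear[OF bounded_bilinear_scaleR]

lemma smooth_on_linear_comp:
  "bounded_linear L \<Longrightarrow> open S \<Longrightarrow> smooth_on S f \<Longrightarrow> smooth_on S (\<lambda>x. L (f x))"
  by (simp add: smooth_on_def k_smooth_on_linear_comp)

lemmas smooth_on_inner_left = smooth_on_linear_comp[OF bounded_linear_inner_left]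

lemma smooth_on_sum:
  "open S \<Longrightarrow> (\<And>i. i \<in> I \<Longrightarrow> smooth_on S (f i)) \<Longrightarrow> smooth_on S (\<lambda>x. \<Sum>i\<in>I. f i x)"
  by (simp add: smooth_on_def k_smooth_on_sum)

lemma smooth_on_Pair:
  "open S \<Longrightarrow> smooth_on S f \<Longrightarrow> smooth_on S g \<Longrightarrow> smooth_on S (\<lambda>x. (f x, g x))"
  by (simp add: smooth_on_def k_smooth_on_Pair)

lemma smooth_on_compose:
  fixes f :: "'b::euclidean_space \<Rightarrow> 'c::real_normed_vector"
  shows "smooth_on T f \<Longrightarrow> open T \<Longrightarrow> smooth_on S g \<Longrightarrow> open S \<Longrightarrow> g ` S \<subseteq> T \<Longrightarrow> smooth_on S (f \<circ> g)"
  by (simp add: smooth_on_def k_smooth_on_compose)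

lemma smooth_on_FD_along:
  fixes f :: "'b::euclidean_space \<Rightarrow> 'c::real_normed_vector"
  assumes f: "smooth_on T f" "open T" and s: "smooth_on S s" "open S" "s ` S \<subseteq> T" and w: "smooth_on S w"
  shows "smooth_on S (\<lambda>x. FD f (s x) (w x))"
proof -
  have "smooth_on S (\<lambda>x. \<Sum>b\<in>Basis. (w x \<bullet> b) *\<^sub>R ((\<lambda>y. FD f y b) \<circ> s) x)"
    by (intro smooth_on_sum smooth_on_scaleR smooth_on_inner_left s w
        smooth_on_compose[OF smooth_on_FD[OF f(1)] f(2)])
  then show ?thesis
  proof (rule smooth_on_cong[OF _ s(2)])
    fix x assume "x \<in> S"
    then have "f differentiable (at (s x))" using smooth_on_differentiable f s by blast
    then show "(\<Sum>b\<in>Basis. (w x \<bullet> b) *\<^sub>R ((\<lambda>y. FD f y b) \<circ> s) x) = FD f (s x) (w x)"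
      unfolding o_apply by (rule linear_expand_Basis[OF FD_linear, symmetric])
  qed
qed

lemma FD_partial_snd:
  assumes "F differentiable (at (x, y))"
  shows "(\<lambda>z. F (x, z)) differentiable (at y)" "FD (\<lambda>z. F (x, z)) y v = FD F (x, y) (0, v)"
proof -
  have 1: "((\<lambda>z. (x, z)) has_derivative (\<lambda>v. (0, v))) (at y)"
    by (auto intro!: derivative_eq_intros)
  have "((\<lambda>z. F (x, z)) has_derivative (\<lambda>v. FD F (x, y) (0, v))) (at y)"
    using diff_chain_at[OF 1, of F] FD_works[OF assms] by (simp add: o_def)
  then show "(\<lambda>z. F (x, z)) differentiable (at y)" "FD (\<lambda>z. F (x, z)) y v = FD F (x, y) (0, v)"
    by (auto simp: FD_eq differentiable_def)
qed

text \<open>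
  Differentiating a function of two variables in the second one only, at a point and in a direction
  that depend smoothly on the first. Fields on a Lie group that are built from the group operation
  have this form in charts.
\<close>

lemma smooth_on_partial_snd:
  fixes F :: "'a::euclidean_space \<times> 'b::euclidean_space \<Rightarrow> 'c::real_normed_vector"
  assumes F: "smooth_on T F" "open T" and S: "open S" "smooth_on S s" "smooth_on S w"
    "\<And>x. x \<in> S \<Longrightarrow> (x, s x) \<in> T"
  shows "smooth_on S (\<lambda>x. FD (\<lambda>y. F (x, y)) (s x) (w x))"
proof -
  have "smooth_on S (\<lambda>x. FD F (x, s x) (0, w x))"
    by (rule smooth_on_FD_along[OF F])
      (use S in \<open>auto intro: smooth_on_Pair smooth_on_ident smooth_on_const\<close>)
  then show ?thesis
    by (rule smooth_on_cong[OF _ S(1)])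
      (simp add: FD_partial_snd(2)[OF smooth_on_differentiable[OF F(1) S(4)]])
qed

section \<open>Symmetry of second derivatives\<close>

text \<open>
  The mean value theorem is applied first in the direction \<open>v\<close> to the increment of \<open>F\<close> along
  \<open>h w\<close>, then in the direction \<open>w\<close>. The left-hand side is symmetric in \<open>v\<close> and \<open>w\<close>, so the same
  expression also yields the iterated derivative in the other order.
\<close>

lemma second_difference_mean_value:
  fixes F :: "'a::real_normed_vector \<Rightarrow> real"
  assumes S: "smooth_on S F" and h: "h > 0"
    and sub: "\<And>s t. 0 \<le> s \<Longrightarrow> s \<le> h \<Longrightarrow> 0 \<le> t \<Longrightarrow> t \<le> h \<Longrightarrow> x + s *\<^sub>R v + t *\<^sub>R w \<in> S"
  obtains s t where "0 < s" "s < h" "0 < t" "t < h"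
    "F (x + h *\<^sub>R v + h *\<^sub>R w) - F (x + h *\<^sub>R v) - F (x + h *\<^sub>R w) + F x
      = h * h * FD (\<lambda>y. FD F y v) (x + s *\<^sub>R v + t *\<^sub>R w) w"
proof -
  define \<phi> where "\<phi> s = F (x + s *\<^sub>R v + h *\<^sub>R w) - F (x + s *\<^sub>R v)" for s
  have d1: "((\<lambda>s. G (a + s *\<^sub>R u)) has_real_derivative FD G (a + s *\<^sub>R u) u) (at s)"
    if "G differentiable (at (a + s *\<^sub>R u))" for G :: "'a \<Rightarrow> real" and a s u
  proof -
    have "((\<lambda>s. a + s *\<^sub>R u) has_derivative (\<lambda>r. r *\<^sub>R u)) (at s)"
      by (auto intro!: derivative_eq_intros)
    from diff_chain_at[OF this, of G] FD_works[OF that]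
    have "((\<lambda>s. G (a + s *\<^sub>R u)) has_derivative (\<lambda>r. FD G (a + s *\<^sub>R u) (r *\<^sub>R u))) (at s)"
      by (simp add: o_def)
    moreover have "(\<lambda>r. FD G (a + s *\<^sub>R u) (r *\<^sub>R u)) = (*) (FD G (a + s *\<^sub>R u) u)"
      using linear_cmul[OF FD_linear[OF that]] by (intro ext) (simp only: real_scaleR_def mult.commute)
    ultimately show ?thesis by (simp add: has_field_derivative_def)
  qed
  have "(\<phi> has_real_derivative FD F (x + s *\<^sub>R v + h *\<^sub>R w) v - FD F (x + s *\<^sub>R v) v) (at s)"
    if "0 \<le> s" "s \<le> h" for s
  proof -
    have a: "F differentiable (at (x + h *\<^sub>R w + s *\<^sub>R v))" "F differentiable (at (x + s *\<^sub>R v))"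
      using sub[of s h] sub[of s 0] that h smooth_on_differentiable[OF S]
      by (auto simp: algebra_simps)
    show ?thesis
      using DERIV_diff[OF d1[OF a(1)] d1[OF a(2)]] unfolding \<phi>_def by (simp add: algebra_simps)
  qed
  from MVT2[OF h this] obtain s where s: "0 < s" "s < h"
    "\<phi> h - \<phi> 0 = h * (FD F (x + s *\<^sub>R v + h *\<^sub>R w) v - FD F (x + s *\<^sub>R v) v)" by auto
  have "((\<lambda>t. FD F (x + s *\<^sub>R v + t *\<^sub>R w) v) has_real_derivative
      FD (\<lambda>y. FD F y v) (x + s *\<^sub>R v + t *\<^sub>R w) w) (at t)" if "0 \<le> t" "t \<le> h" for t
    by (rule d1, rule smooth_on_differentiable[OF smooth_on_FD[OF S]], rule sub) (use s that in auto)
  from MVT2[OF h this] obtain t where t: "0 < t" "t < h"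
    "FD F (x + s *\<^sub>R v + h *\<^sub>R w) v - FD F (x + s *\<^sub>R v + 0 *\<^sub>R w) v
      = h * FD (\<lambda>y. FD F y v) (x + s *\<^sub>R v + t *\<^sub>R w) w" by auto
  show ?thesis
    using that[OF s(1,2) t(1,2)] s(3) t(3) by (simp add: \<phi>_def algebra_simps)
qed

text \<open>
  Both orders of differentiation are values, at points near \<open>x\<close>, of the same second difference
  quotient. If they differed at \<open>x\<close>, continuity would keep them apart near \<open>x\<close>.
\<close>

lemma FD_FD_commute:
  fixes F :: "'a::real_normed_vector \<Rightarrow> real"
  assumes S: "smooth_on S F" "open S" "x \<in> S"
  shows "FD (\<lambda>y. FD F y v) x w = FD (\<lambda>y. FD F y w) x v"
proof (rule ccontr)
  define P where "P v w y = FD (\<lambda>y. FD F y v) y w" for v w y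
  assume "\<not> ?thesis"
  then have e: "dist (P v w x) (P w v x) / 2 > 0" (is "?e > 0") by (simp add: P_def)
  have "isCont (P v w) x" for v w
    using smooth_on_continuous[OF smooth_on_FD[OF smooth_on_FD[OF S(1)]]] S(2,3)
    unfolding P_def[abs_def] by (metis continuous_on_eq_continuous_at)
  then have ev: "\<forall>\<^sub>F y in nhds x. dist (P v w y) (P v w x) < ?e" for v w
    by (intro tendstoD[OF _ e]) (simp only: continuous_at tendsto_at_iff_tendsto_nhds)
  have "\<forall>\<^sub>F y in nhds x. y \<in> S" using S by (simp add: eventually_nhds_in_open)
  with ev[of v w] ev[of w v]
  have "\<forall>\<^sub>F y in nhds x. y \<in> S \<and> dist (P v w y) (P v w x) < ?e \<and> dist (P w v y) (P w v x) < ?e"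
    by eventually_elim simp
  then obtain d where d: "d > 0" and near: "\<And>y. dist y x < d \<Longrightarrow>
      y \<in> S \<and> dist (P v w y) (P v w x) < ?e \<and> dist (P w v y) (P w v x) < ?e"
    unfolding eventually_nhds_metric by blast
  \<comment> \<open>The parallelogram spanned by \<open>h v\<close> and \<open>h w\<close> has to fit into the ball of radius \<open>d\<close>; the
      summand 1 covers the case \<open>v = w = 0\<close>.\<close>
  define N where "N = norm v + norm w + 1"
  have N: "N > 0" by (simp add: N_def add_nonneg_pos)
  define h where "h = d / (2 * N)"
  have h: "h > 0" using d N unfolding h_def by simp
  have hn: "h * (norm v + norm w) < d"
  proof -
    have "h * (norm v + norm w) \<le> h * N" using h by (simp add: N_def)
    also have "\<dots> = d / 2" using N unfolding h_def by simp
    finally show ?thesis using d by simp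
  qed
  have dd: "dist (x + s *\<^sub>R v + t *\<^sub>R w) x < d" if "0 \<le> s" "s \<le> h" "0 \<le> t" "t \<le> h" for s t
  proof -
    have "dist (x + s *\<^sub>R v + t *\<^sub>R w) x = norm (s *\<^sub>R v + t *\<^sub>R w)" by (simp add: dist_norm)
    also have "\<dots> \<le> s * norm v + t * norm w"
      using norm_triangle_ineq[of "s *\<^sub>R v" "t *\<^sub>R w"] that by simp
    also have "\<dots> \<le> h * norm v + h * norm w" using that by (intro add_mono mult_right_mono) auto
    also have "\<dots> < d" using hn by (simp add: algebra_simps)
    finally show ?thesis .
  qed
  obtain s t where st: "0 < s" "s < h" "0 < t" "t < h"
    "F (x + h *\<^sub>R v + h *\<^sub>R w) - F (x + h *\<^sub>R v) - F (x + h *\<^sub>R w) + F x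
      = h * h * P v w (x + s *\<^sub>R v + t *\<^sub>R w)"
  proof (rule second_difference_mean_value[OF S(1) h, of x v w])
    show "x + s *\<^sub>R v + t *\<^sub>R w \<in> S" if "0 \<le> s" "s \<le> h" "0 \<le> t" "t \<le> h" for s t
      using near[OF dd[OF that]] by simp
  qed (auto simp: P_def)
  obtain s' t' where st': "0 < s'" "s' < h" "0 < t'" "t' < h"
    "F (x + h *\<^sub>R w + h *\<^sub>R v) - F (x + h *\<^sub>R w) - F (x + h *\<^sub>R v) + F x
      = h * h * P w v (x + s' *\<^sub>R w + t' *\<^sub>R v)"
  proof (rule second_difference_mean_value[OF S(1) h, of x w v])
    show "x + s *\<^sub>R w + t *\<^sub>R v \<in> S" if "0 \<le> s" "s \<le> h" "0 \<le> t" "t \<le> h" for s t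
      using near[OF dd[OF that(3,4,1,2)]] by (simp add: add.commute add.left_commute)
  qed (auto simp: P_def)
  have "h * h * P v w (x + s *\<^sub>R v + t *\<^sub>R w) = h * h * P w v (x + s' *\<^sub>R w + t' *\<^sub>R v)"
    using st(5) st'(5) by (simp add: algebra_simps)
  then have "P v w (x + s *\<^sub>R v + t *\<^sub>R w) = P w v (x + s' *\<^sub>R w + t' *\<^sub>R v)" using h by simp
  moreover have "dist (P v w (x + s *\<^sub>R v + t *\<^sub>R w)) (P v w x) < ?e"
    using near[OF dd] st by simp
  moreover have "dist (P w v (x + s' *\<^sub>R w + t' *\<^sub>R v)) (P w v x) < ?e"
    using near[OF dd[of t' s']] st' by (simp add: add.commute add.left_commute)
  ultimately show False by (simp add: dist_real_def) (smt (verit) field_sum_of_halves)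
qed

section \<open>Smooth functions on a manifold\<close>

locale manifold =
  fixes A :: "('g::topological_space, 'e::euclidean_space) chart set"
  assumes atlas: "smooth_atlas A"
begin

definition chart_dom :: "('g, 'e) chart \<Rightarrow> 'g set \<Rightarrow> 'e set" where
  "chart_dom c W = {x \<in> chart_image c. chart_inv c x \<in> W}"

lemma chart_open: "c \<in> A \<Longrightarrow> open (fst c)" "c \<in> A \<Longrightarrow> open (chart_image c)"
  using atlas by (auto simp: smooth_atlas_def is_chart_def)

lemma chart_homeo: "c \<in> A \<Longrightarrow> homeomorphism (fst c) (chart_image c) (snd c) (chart_inv c)"
  using atlas by (auto simp: smooth_atlas_def is_chart_def)

lemma chart_inv_snd: "c \<in> A \<Longrightarrow> p \<in> fst c \<Longrightarrow> chart_inv c (snd c p) = p"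
  using chart_homeo by (metis homeomorphism_apply1)

lemma snd_chart_inv: "c \<in> A \<Longrightarrow> x \<in> chart_image c \<Longrightarrow> snd c (chart_inv c x) = x"
  using chart_homeo by (metis homeomorphism_apply2)

lemma chart_inv_in: "c \<in> A \<Longrightarrow> x \<in> chart_image c \<Longrightarrow> chart_inv c x \<in> fst c"
  using chart_homeo by (metis homeomorphism_image2 imageI)

lemma snd_in_chart_image: "p \<in> fst c \<Longrightarrow> snd c p \<in> chart_image c"
  by (simp add: chart_image_def)

lemma continuous_chart_inv: "c \<in> A \<Longrightarrow> continuous_on (chart_image c) (chart_inv c)"
  using chart_homeo homeomorphism_cont2 by blast

lemma continuous_snd_chart: "c \<in> A \<Longrightarrow> continuous_on (fst c) (snd c)"
  using chart_homeo homeomorphism_cont1 by blast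

lemma chart_covers: obtains c where "c \<in> A" "p \<in> fst c"
  using atlas unfolding smooth_atlas_def by blast

lemma open_chart_dom: "c \<in> A \<Longrightarrow> open W \<Longrightarrow> open (chart_dom c W)"
  using continuous_open_preimage[OF continuous_chart_inv chart_open(2)]
  by (simp add: chart_dom_def Int_def vimage_def)

lemma snd_in_chart_dom: "c \<in> A \<Longrightarrow> p \<in> fst c \<Longrightarrow> p \<in> W \<Longrightarrow> snd c p \<in> chart_dom c W"
  by (simp add: chart_dom_def chart_inv_snd snd_in_chart_image)

lemma chart_dom_eq: "c \<in> A \<Longrightarrow> chart_dom c W = snd c ` (fst c \<inter> W)"
proof (intro subset_antisym subsetI)
  fix x assume "c \<in> A" "x \<in> chart_dom c W"
  then show "x \<in> snd c ` (fst c \<inter> W)"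
    by (intro image_eqI[of _ _ "chart_inv c x"]) (auto simp: chart_dom_def snd_chart_inv chart_inv_in)
qed (auto simp: snd_in_chart_dom)

lemma smooth_fun_on_iff:
  "smooth_fun_on A W f \<longleftrightarrow>
    open W \<and> (\<forall>c\<in>A. smooth_on (chart_dom c W) (\<lambda>x. f (chart_inv c x)))"
  by (simp add: smooth_fun_on_def chart_dom_eq comp_def)

lemma smooth_fun_on_chart:
  "smooth_fun_on A W f \<Longrightarrow> c \<in> A \<Longrightarrow> smooth_on (chart_dom c W) (\<lambda>x. f (chart_inv c x))"
  by (simp add: smooth_fun_on_iff)

lemma smooth_transition:
  "c \<in> A \<Longrightarrow> d \<in> A \<Longrightarrow> smooth_on (chart_dom c (fst d)) (\<lambda>x. snd d (chart_inv c x))"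
  using atlas by (simp add: smooth_atlas_def chart_dom_eq comp_def)

text \<open>Near each point one chart is enough, because the transition maps are smooth.\<close>

lemma smooth_fun_onI:
  assumes W: "open W"
    and loc: "\<And>p. p \<in> W \<Longrightarrow> \<exists>c\<in>A. p \<in> fst c \<and> (\<exists>U. open U \<and> snd c p \<in> U \<and> U \<subseteq> chart_image c \<and>
      smooth_on U (\<lambda>x. f (chart_inv c x)))"
  shows "smooth_fun_on A W f"
  unfolding smooth_fun_on_iff
proof (intro conjI W ballI smooth_on_local)
  fix d x assume d: "d \<in> A" and x: "x \<in> chart_dom d W"
  then obtain c U where c: "c \<in> A" "chart_inv d x \<in> fst c" and U: "open U" "snd c (chart_inv d x) \<in> U"
    "U \<subseteq> chart_image c" "smooth_on U (\<lambda>x. f (chart_inv c x))"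
    using loc[of "chart_inv d x"] by (auto simp: chart_dom_def)
  define V where "V = chart_dom d (fst c) \<inter> (\<lambda>y. snd c (chart_inv d y)) -` U"
  have "open V" unfolding V_def
    by (rule continuous_open_preimage[OF smooth_on_continuous[OF smooth_transition[OF d c(1)]]
        open_chart_dom[OF d chart_open(1)[OF c(1)]] U(1)])
  moreover have "x \<in> V" using c U x by (simp add: V_def chart_dom_def)
  moreover have "smooth_on V (\<lambda>x. f (chart_inv d x))"
  proof (rule smooth_on_cong[OF smooth_on_compose[OF U(4,1)] \<open>open V\<close>])
    show "smooth_on V (\<lambda>y. snd c (chart_inv d y))"
      by (rule smooth_on_subset[OF smooth_transition[OF d c(1)]]) (simp add: V_def)
    show "((\<lambda>x. f (chart_inv c x)) \<circ> (\<lambda>y. snd c (chart_inv d y))) y = f (chart_inv d y)" if "y \<in> V" for y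
      using that c d by (simp add: V_def chart_dom_def chart_inv_snd)
  qed (use \<open>open V\<close> in \<open>auto simp: V_def\<close>)
  ultimately show "\<exists>U. open U \<and> x \<in> U \<and> smooth_on U (\<lambda>x. f (chart_inv d x))" by blast
qed

lemma smooth_fun_on_subset: "smooth_fun_on A W f \<Longrightarrow> open V \<Longrightarrow> V \<subseteq> W \<Longrightarrow> smooth_fun_on A V f"
  unfolding smooth_fun_on_iff by (auto simp: chart_dom_def elim!: smooth_on_subset)

lemma smooth_fun_on_cong:
  "smooth_fun_on A W f \<Longrightarrow> (\<And>p. p \<in> W \<Longrightarrow> f p = h p) \<Longrightarrow> smooth_fun_on A W h"
  unfolding smooth_fun_on_iff
proof (intro conjI ballI)
  fix c assume *: "\<And>p. p \<in> W \<Longrightarrow> f p = h p" and c: "c \<in> A"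
    and f: "open W \<and> (\<forall>c\<in>A. smooth_on (chart_dom c W) (\<lambda>x. f (chart_inv c x)))"
  from f c have "smooth_on (chart_dom c W) (\<lambda>x. f (chart_inv c x))" "open W" by auto
  then show "smooth_on (chart_dom c W) (\<lambda>x. h (chart_inv c x))"
    by (rule smooth_on_cong[OF _ open_chart_dom[OF c]]) (simp add: * chart_dom_def)
qed auto

lemma smooth_fun_on_local:
  assumes "open W" "\<And>p. p \<in> W \<Longrightarrow> smooth_near A p f"
  shows "smooth_fun_on A W f"
proof (rule smooth_fun_onI[OF assms(1)])
  fix p assume "p \<in> W"
  then obtain V where V: "p \<in> V" "smooth_fun_on A V f" using assms(2) by (auto simp: smooth_near_def)
  obtain c where c: "c \<in> A" "p \<in> fst c" by (rule chart_covers)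
  from V have "open V" by (simp add: smooth_fun_on_iff)
  with V c have "open (chart_dom c V)" "snd c p \<in> chart_dom c V" "chart_dom c V \<subseteq> chart_image c"
    "smooth_on (chart_dom c V) (\<lambda>x. f (chart_inv c x))"
    using open_chart_dom snd_in_chart_dom smooth_fun_on_chart by (auto simp: chart_dom_def)
  with c show "\<exists>c\<in>A. p \<in> fst c \<and> (\<exists>U. open U \<and> snd c p \<in> U \<and> U \<subseteq> chart_image c \<and>
      smooth_on U (\<lambda>x. f (chart_inv c x)))" by blast
qed

lemma smooth_fun_on_const: "open W \<Longrightarrow> smooth_fun_on A W (\<lambda>p. r)"
  by (simp add: smooth_fun_on_iff smooth_on_const)

lemma smooth_fun_on_add:
  "smooth_fun_on A W f \<Longrightarrow> smooth_fun_on A W h \<Longrightarrow> smooth_fun_on A W (\<lambda>p. f p + h p)"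
  by (simp add: smooth_fun_on_iff smooth_on_add open_chart_dom)

lemma smooth_fun_on_mult:
  "smooth_fun_on A W f \<Longrightarrow> smooth_fun_on A W h \<Longrightarrow> smooth_fun_on A W (\<lambda>p. f p * h p)"
  by (simp add: smooth_fun_on_iff smooth_on_mult open_chart_dom)

lemma smooth_fun_on_diff:
  assumes "smooth_fun_on A W f" "smooth_fun_on A W h"
  shows "smooth_fun_on A W (\<lambda>p. f p - h p)"
proof -
  have "open W" using assms by (simp add: smooth_fun_on_iff)
  then have "smooth_fun_on A W (\<lambda>p. f p + (- 1) * h p)"
    by (intro smooth_fun_on_add smooth_fun_on_mult smooth_fun_on_const assms)
  then show ?thesis by simp
qed

lemma smooth_fun_on_sum:
  assumes "open W" "\<And>i. i \<in> I \<Longrightarrow> smooth_fun_on A W (f i)"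
  shows "smooth_fun_on A W (\<lambda>p. \<Sum>i\<in>I. f i p)"
  using assms by (simp add: smooth_fun_on_iff smooth_on_sum open_chart_dom)

lemma smooth_fun_on_chart_coordinate:
  assumes "c \<in> A" shows "smooth_fun_on A (fst c) (\<lambda>q. snd c q \<bullet> b)"
  unfolding smooth_fun_on_iff
  by (intro conjI chart_open assms ballI smooth_on_inner_left open_chart_dom smooth_transition)

lemma smooth_nearE:
  assumes "smooth_near A p f" obtains W where "open W" "p \<in> W" "smooth_fun_on A W f"
  using assms by (auto simp: smooth_near_def smooth_fun_on_iff)

lemma smooth_nearI: "smooth_fun_on A W f \<Longrightarrow> p \<in> W \<Longrightarrow> smooth_near A p f"
  by (auto simp: smooth_near_def)

lemma smooth_near2:
  assumes "smooth_near A p f" "smooth_near A p h"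
  obtains W where "open W" "p \<in> W" "smooth_fun_on A W f" "smooth_fun_on A W h"
proof -
  obtain W1 W2 where "open W1" "p \<in> W1" "smooth_fun_on A W1 f" "open W2" "p \<in> W2" "smooth_fun_on A W2 h"
    using assms smooth_nearE by metis
  then show ?thesis using that[of "W1 \<inter> W2"] by (auto intro: smooth_fun_on_subset)
qed

lemma smooth_near_add: "smooth_near A p f \<Longrightarrow> smooth_near A p h \<Longrightarrow> smooth_near A p (\<lambda>q. f q + h q)"
  by (erule (1) smooth_near2) (auto intro: smooth_nearI smooth_fun_on_add)

lemma smooth_near_mult: "smooth_near A p f \<Longrightarrow> smooth_near A p h \<Longrightarrow> smooth_near A p (\<lambda>q. f q * h q)"
  by (erule (1) smooth_near2) (auto intro: smooth_nearI smooth_fun_on_mult)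

lemma smooth_near_const: "smooth_near A p (\<lambda>q. r)"
  using smooth_nearI[OF smooth_fun_on_const[OF open_UNIV]] by simp

lemma smooth_near_sum:
  "(\<And>i. i \<in> I \<Longrightarrow> smooth_near A p (f i)) \<Longrightarrow> smooth_near A p (\<lambda>q. \<Sum>i\<in>I. f i q)"
  by (induction I rule: infinite_finite_induct) (auto intro: smooth_near_const smooth_near_add)

lemma smooth_near_chart:
  assumes "smooth_near A p f" "c \<in> A" "p \<in> fst c"
  obtains U where "open U" "snd c p \<in> U" "U \<subseteq> chart_image c" "smooth_on U (\<lambda>x. f (chart_inv c x))"
    "\<And>x. x \<in> U \<Longrightarrow> smooth_near A (chart_inv c x) f"
proof -
  obtain W where W: "open W" "p \<in> W" "smooth_fun_on A W f" using assms(1) smooth_nearE by blast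
  show ?thesis
    by (rule that[of "chart_dom c W"])
      (use W assms in \<open>auto simp: chart_dom_def chart_inv_snd snd_in_chart_image
         intro: open_chart_dom[unfolded chart_dom_def] smooth_fun_on_chart[unfolded chart_dom_def] smooth_nearI\<close>)
qed

lemma smooth_nearI_chart:
  assumes c: "c \<in> A" "p \<in> fst c" and U: "open U" "snd c p \<in> U" "U \<subseteq> chart_image c"
    "smooth_on U (\<lambda>x. f (chart_inv c x))"
  shows "smooth_near A p f"
proof (rule smooth_nearI)
  let ?W = "fst c \<inter> snd c -` U"
  show "p \<in> ?W" using c U by simp
  show "smooth_fun_on A ?W f"
  proof (rule smooth_fun_onI)
    show "open ?W" by (rule continuous_open_preimage[OF continuous_snd_chart chart_open(1) U(1)]) fact+
    fix q assume "q \<in> ?W"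
    then have "q \<in> fst c \<and> (\<exists>U. open U \<and> snd c q \<in> U \<and> U \<subseteq> chart_image c \<and>
        smooth_on U (\<lambda>x. f (chart_inv c x)))"
      using U by blast
    with c show "\<exists>c\<in>A. q \<in> fst c \<and> (\<exists>U. open U \<and> snd c q \<in> U \<and> U \<subseteq> chart_image c \<and>
        smooth_on U (\<lambda>x. f (chart_inv c x)))" by blast
  qed
qed

lemma smooth_near_differentiable:
  "smooth_near A p f \<Longrightarrow> c \<in> A \<Longrightarrow> p \<in> fst c \<Longrightarrow> (\<lambda>x. f (chart_inv c x)) differentiable (at (snd c p))"
  using smooth_near_chart[of p f c] smooth_on_differentiable by metis

section \<open>Tangent vectors in charts\<close>

definition chart_vector :: "('g, 'e) chart \<Rightarrow> 'g \<Rightarrow> 'e \<Rightarrow> 'g tangent_vector" where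
  "chart_vector c p v =
    (\<lambda>f. if smooth_near A p f then FD (\<lambda>x. f (chart_inv c x)) (snd c p) v else 0)"

text \<open>
  The coordinates of a tangent vector are its values on the coordinate functions, so the
  coordinates of a smooth vector field are smooth.
\<close>

definition chart_coords :: "('g, 'e) chart \<Rightarrow> 'g tangent_vector \<Rightarrow> 'e" where
  "chart_coords c u = (\<Sum>b\<in>Basis. u (\<lambda>q. snd c q \<bullet> b) *\<^sub>R b)"

text \<open>This is the chain rule for \<open>f \<circ> \<gamma> = (f \<circ> c\<^sup>-\<^sup>1) \<circ> (c \<circ> \<gamma>)\<close>.\<close>

lemma velocity_eq_chart_vector:
  assumes c: "c \<in> A" "\<gamma> 0 \<in> fst c" and \<gamma>: "smooth_curve A \<epsilon> \<gamma>"
  shows "velocity A \<gamma> = chart_vector c (\<gamma> 0) (FD (snd c \<circ> \<gamma>) 0 1)"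
proof
  fix f
  have e: "\<epsilon> > 0" and cont: "continuous_on {-\<epsilon><..<\<epsilon>} \<gamma>"
    and sm: "smooth_on {t. -\<epsilon> < t \<and> t < \<epsilon> \<and> \<gamma> t \<in> fst c} (snd c \<circ> \<gamma>)"
    using \<gamma> c by (auto simp: smooth_curve_def)
  have op: "open {t. -\<epsilon> < t \<and> t < \<epsilon> \<and> \<gamma> t \<in> fst c}"
    using continuous_open_preimage[OF cont open_greaterThanLessThan chart_open(1)[OF c(1)]]
    by (simp add: Int_def vimage_def conj_assoc)
  show "velocity A \<gamma> f = chart_vector c (\<gamma> 0) (FD (snd c \<circ> \<gamma>) 0 1) f"
  proof (cases "smooth_near A (\<gamma> 0) f")
    case True
    let ?F = "\<lambda>x. f (chart_inv c x)" and ?v = "FD (snd c \<circ> \<gamma>) 0"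
    have d\<gamma>: "((snd c \<circ> \<gamma>) has_derivative ?v) (at 0)"
      by (intro FD_works smooth_on_differentiable[OF sm]) (use e c in auto)
    have dF: "(?F has_derivative FD ?F (snd c (\<gamma> 0))) (at (snd c (\<gamma> 0)))"
      by (intro FD_works smooth_near_differentiable True c)
    have lin: "linear (FD ?F (snd c (\<gamma> 0)))" "linear ?v"
      using dF d\<gamma> by (auto dest: has_derivative_linear)
    have "((?F \<circ> (snd c \<circ> \<gamma>)) has_derivative (FD ?F (snd c (\<gamma> 0)) \<circ> ?v)) (at 0)"
      by (rule diff_chain_at[OF d\<gamma>]) (use dF in simp)
    then have "((f \<circ> \<gamma>) has_derivative (FD ?F (snd c (\<gamma> 0)) \<circ> ?v)) (at 0)"
      by (rule has_derivative_transform_within_open[OF _ op]) (use e c in \<open>auto simp: chart_inv_snd\<close>)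
    moreover have "(FD ?F (snd c (\<gamma> 0)) \<circ> ?v) = (*) (FD ?F (snd c (\<gamma> 0)) (?v 1))"
    proof
      fix r :: real
      show "(FD ?F (snd c (\<gamma> 0)) \<circ> ?v) r = FD ?F (snd c (\<gamma> 0)) (?v 1) * r"
        using linear_cmul[OF lin(2), of r 1] linear_cmul[OF lin(1), of r "?v 1"]
        by (simp add: mult.commute)
    qed
    ultimately have "((f \<circ> \<gamma>) has_real_derivative FD ?F (snd c (\<gamma> 0)) (?v 1)) (at 0)"
      by (simp add: has_field_derivative_def)
    then show ?thesis using True by (simp add: velocity_def chart_vector_def DERIV_imp_deriv)
  qed (simp add: velocity_def chart_vector_def)
qed

text \<open>The curve that is a straight line in the chart has the prescribed velocity.\<close>

lemma chart_vector_in_tangent_space: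
  assumes c: "c \<in> A" "p \<in> fst c"
  shows "chart_vector c p v \<in> tangent_space A p"
proof -
  define \<sigma> where "\<sigma> t = snd c p + t *\<^sub>R v" for t :: real
  have \<sigma>0: "\<sigma> 0 = snd c p" by (simp add: \<sigma>_def)
  have \<sigma>c: "continuous_on S \<sigma>" for S unfolding \<sigma>_def by (intro continuous_intros)
  have \<sigma>s: "smooth_on S \<sigma>" if "open S" for S unfolding \<sigma>_def
    by (intro smooth_on_add that smooth_on_const smooth_on_bounded_linear bounded_linear_scaleR_left)
  have "open (\<sigma> -` chart_image c)"
    using \<sigma>c chart_open(2)[OF c(1)] continuous_on_open_vimage[OF open_UNIV, of \<sigma>] by auto
  moreover have "0 \<in> \<sigma> -` chart_image c" using c by (simp add: \<sigma>0 snd_in_chart_image)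
  ultimately obtain \<epsilon> where e: "\<epsilon> > 0" "ball 0 \<epsilon> \<subseteq> \<sigma> -` chart_image c"
    by (meson open_contains_ball)
  have im: "\<sigma> t \<in> chart_image c" if "-\<epsilon> < t" "t < \<epsilon>" for t
    using e(2) that by (auto simp: ball_def dist_real_def subset_iff)
  define \<gamma> where "\<gamma> t = chart_inv c (\<sigma> t)" for t
  have \<gamma>0: "\<gamma> 0 = p" using c by (simp add: \<gamma>_def \<sigma>0 chart_inv_snd)
  have cont: "continuous_on {-\<epsilon><..<\<epsilon>} \<gamma>" unfolding \<gamma>_def
    by (rule continuous_on_compose2[OF continuous_chart_inv[OF c(1)] \<sigma>c]) (use im in auto)
  have "smooth_curve A \<epsilon> \<gamma>" unfolding smooth_curve_def
  proof (intro conjI e cont ballI)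
    fix d assume d: "d \<in> A"
    let ?S = "{t. - \<epsilon> < t \<and> t < \<epsilon> \<and> \<gamma> t \<in> fst d}"
    have op: "open ?S"
      using continuous_open_preimage[OF cont open_greaterThanLessThan chart_open(1)[OF d]]
      by (simp add: Int_def vimage_def conj_assoc)
    have "smooth_on ?S ((\<lambda>x. snd d (chart_inv c x)) \<circ> \<sigma>)"
      by (rule smooth_on_compose[OF smooth_transition[OF c(1) d] open_chart_dom \<sigma>s[OF op] op])
        (use im in \<open>auto simp: chart_dom_def \<gamma>_def c d chart_open\<close>)
    then show "smooth_on ?S (snd d \<circ> \<gamma>)" by (simp add: comp_def \<gamma>_def)
  qed
  moreover have "velocity A \<gamma> = chart_vector c p v"
  proof -
    have "(\<sigma> has_derivative (\<lambda>t. t *\<^sub>R v)) (at 0)" unfolding \<sigma>_def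
      by (auto intro!: derivative_eq_intros)
    then have "((snd c \<circ> \<gamma>) has_derivative (\<lambda>t. t *\<^sub>R v)) (at 0)"
      by (rule has_derivative_transform_within_open[OF _ open_greaterThanLessThan[of "-\<epsilon>" \<epsilon>]])
        (use e im c in \<open>auto simp: \<gamma>_def snd_chart_inv\<close>)
    then show ?thesis
      using velocity_eq_chart_vector[OF c(1) _ calculation] c by (simp add: \<gamma>0 FD_eq)
  qed
  ultimately show ?thesis
    unfolding tangent_space_def using \<gamma>0 by (intro CollectI exI[of _ \<gamma>] exI[of _ \<epsilon>]) simp
qed

text \<open>
  With this description, tangent spaces are vector spaces and tangent vectors are derivations,
  neither of which is visible for velocities of curves.
\<close>

lemma tangent_space_eq:
  assumes "c \<in> A" "p \<in> fst c"
  shows "tangent_space A p = range (chart_vector c p)"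
proof
  show "tangent_space A p \<subseteq> range (chart_vector c p)"
    using velocity_eq_chart_vector[OF assms(1)] assms(2) unfolding tangent_space_def by blast
qed (use chart_vector_in_tangent_space[OF assms] in auto)

lemma chart_coords_chart_vector:
  assumes "c \<in> A" "p \<in> fst c"
  shows "chart_coords c (chart_vector c p v) = v"
proof -
  have "chart_vector c p v (\<lambda>q. snd c q \<bullet> b) = v \<bullet> b" for b
  proof -
    have "((\<lambda>x. snd c (chart_inv c x) \<bullet> b) has_derivative (\<lambda>v. v \<bullet> b)) (at (snd c p))"
      by (rule has_derivative_transform_within_open[OF
            bounded_linear_imp_has_derivative[OF bounded_linear_inner_left] chart_open(2)[OF assms(1)]])
        (use assms in \<open>auto simp: snd_chart_inv snd_in_chart_image\<close>)
    moreover have "smooth_near A p (\<lambda>q. snd c q \<bullet> b)"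
      by (rule smooth_nearI[OF smooth_fun_on_chart_coordinate]) (use assms in auto)
    ultimately show ?thesis by (simp add: chart_vector_def FD_eq)
  qed
  then show ?thesis by (simp add: chart_coords_def euclidean_representation)
qed

lemma tangent_vector_in_chart:
  assumes "c \<in> A" "p \<in> fst c" "u \<in> tangent_space A p"
  shows "u = chart_vector c p (chart_coords c u)"
  using assms(3) chart_coords_chart_vector[OF assms(1,2)]
  by (auto simp: tangent_space_eq[OF assms(1,2)])

lemma chart_vector_combination:
  assumes "c \<in> A" "p \<in> fst c"
  shows "(\<lambda>f. r * chart_vector c p v f + s * chart_vector c p w f) = chart_vector c p (r *\<^sub>R v + s *\<^sub>R w)"
proof
  fix f
  show "r * chart_vector c p v f + s * chart_vector c p w f = chart_vector c p (r *\<^sub>R v + s *\<^sub>R w) f"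
  proof (cases "smooth_near A p f")
    case True
    then show ?thesis
      using FD_linear[OF smooth_near_differentiable[OF True assms]]
      by (simp add: chart_vector_def linear_add linear_cmul)
  qed (simp add: chart_vector_def)
qed

lemma tangent_combination:
  assumes "u \<in> tangent_space A p" "v \<in> tangent_space A p"
  shows "(\<lambda>f. r * u f + s * v f) \<in> tangent_space A p"
proof -
  obtain c where c: "c \<in> A" "p \<in> fst c" by (rule chart_covers)
  with assms obtain a b where "u = chart_vector c p a" "v = chart_vector c p b"
    by (auto simp: tangent_space_eq)
  then show ?thesis
    by (simp only: chart_vector_combination[OF c] chart_vector_in_tangent_space[OF c])
qed

lemma tangent_zero: "(\<lambda>f. 0) \<in> tangent_space A p"
proof -
  obtain c where c: "c \<in> A" "p \<in> fst c" by (rule chart_covers)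
  show ?thesis using tangent_combination[of _ p _ 0 0] chart_vector_in_tangent_space[OF c] by fastforce
qed

lemma tangent_sum:
  assumes "\<And>i. i \<in> I \<Longrightarrow> u i \<in> tangent_space A p"
  shows "(\<lambda>f. \<Sum>i\<in>I. r i * u i f) \<in> tangent_space A p"
  using assms
proof (induction I rule: infinite_finite_induct)
  case (insert i I)
  then show ?case using tangent_combination[of "u i" p "\<lambda>f. \<Sum>i\<in>I. r i * u i f" "r i" 1] by simp
qed (simp_all add: tangent_zero)

lemma tangent_not_smooth: "u \<in> tangent_space A p \<Longrightarrow> \<not> smooth_near A p f \<Longrightarrow> u f = 0"
  by (auto simp: tangent_space_def velocity_def)

lemma tangent_add:
  assumes u: "u \<in> tangent_space A p" and f: "smooth_near A p f" "smooth_near A p h"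
  shows "u (\<lambda>q. f q + h q) = u f + u h"
proof -
  obtain c where c: "c \<in> A" "p \<in> fst c" by (rule chart_covers)
  then obtain v where u: "u = chart_vector c p v" using u by (auto simp: tangent_space_eq)
  have "FD (\<lambda>x. f (chart_inv c x) + h (chart_inv c x)) (snd c p) =
    (\<lambda>v. FD (\<lambda>x. f (chart_inv c x)) (snd c p) v + FD (\<lambda>x. h (chart_inv c x)) (snd c p) v)"
    by (intro FD_eq has_derivative_add FD_works smooth_near_differentiable f c)
  then show ?thesis using f smooth_near_add[OF f] by (simp add: u chart_vector_def)
qed

lemma tangent_mult:
  assumes u: "u \<in> tangent_space A p" and f: "smooth_near A p f" "smooth_near A p h"
  shows "u (\<lambda>q. f q * h q) = u f * h p + f p * u h"
proof -
  obtain c where c: "c \<in> A" "p \<in> fst c" by (rule chart_covers)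
  then obtain v where u: "u = chart_vector c p v" using u by (auto simp: tangent_space_eq)
  have "FD (\<lambda>x. f (chart_inv c x) * h (chart_inv c x)) (snd c p) =
    (\<lambda>v. f (chart_inv c (snd c p)) * FD (\<lambda>x. h (chart_inv c x)) (snd c p) v +
       FD (\<lambda>x. f (chart_inv c x)) (snd c p) v * h (chart_inv c (snd c p)))"
    by (intro FD_eq has_derivative_mult FD_works smooth_near_differentiable f c)
  then show ?thesis using f smooth_near_mult[OF f] by (simp add: u chart_vector_def chart_inv_snd c)
qed

lemma tangent_const: "u \<in> tangent_space A p \<Longrightarrow> u (\<lambda>q. r) = 0"
proof -
  assume u: "u \<in> tangent_space A p"
  obtain c where c: "c \<in> A" "p \<in> fst c" by (rule chart_covers)
  then obtain v where "u = chart_vector c p v" using u by (auto simp: tangent_space_eq)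
  then show ?thesis by (simp add: chart_vector_def)
qed

lemma tangent_sum_fun:
  assumes u: "u \<in> tangent_space A p" and f: "\<And>i. i \<in> I \<Longrightarrow> smooth_near A p (f i)"
  shows "u (\<lambda>q. \<Sum>i\<in>I. f i q) = (\<Sum>i\<in>I. u (f i))"
  using f
  by (induction I rule: infinite_finite_induct)
    (auto simp: tangent_const[OF u] tangent_add[OF u] smooth_near_sum)

section \<open>Vector fields and their brackets\<close>

lemma field_tangent: "smooth_vector_field A X \<Longrightarrow> X p \<in> tangent_space A p"
  by (simp add: smooth_vector_field_def)

lemma field_smooth: "smooth_vector_field A X \<Longrightarrow> smooth_fun_on A W f \<Longrightarrow> smooth_fun_on A W (\<lambda>p. X p f)"
  by (simp add: smooth_vector_field_def)

lemma field_smooth_near: "smooth_vector_field A X \<Longrightarrow> smooth_near A p f \<Longrightarrow> smooth_near A p (\<lambda>p. X p f)"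
  using field_smooth unfolding smooth_near_def by blast

lemma smooth_field_sum:
  assumes "\<And>i. i \<in> I \<Longrightarrow> smooth_vector_field A (X i)" "\<And>i. i \<in> I \<Longrightarrow> smooth_fun_on A UNIV (h i)"
  shows "smooth_vector_field A (\<lambda>p f. \<Sum>i\<in>I. h i p * X i p f)"
  unfolding smooth_vector_field_def
proof (intro conjI allI impI)
  show "(\<lambda>f. \<Sum>i\<in>I. h i p * X i p f) \<in> tangent_space A p" for p
    using assms(1) by (intro tangent_sum) (simp add: field_tangent)
  fix W f assume f: "smooth_fun_on A W f"
  then have W: "open W" by (simp add: smooth_fun_on_iff)
  show "smooth_fun_on A W (\<lambda>p. \<Sum>i\<in>I. h i p * X i p f)"
    by (intro smooth_fun_on_sum smooth_fun_on_mult W field_smooth[OF assms(1) f]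
        smooth_fun_on_subset[OF assms(2) W subset_UNIV])
qed

lemma smooth_field_coords:
  assumes X: "smooth_vector_field A X" and c: "c \<in> A"
  shows "smooth_on (chart_image c) (\<lambda>x. chart_coords c (X (chart_inv c x)))"
  unfolding chart_coords_def
proof (intro smooth_on_sum smooth_on_scaleR smooth_on_const chart_open c)
  fix b
  have "chart_dom c (fst c) = chart_image c" using chart_inv_in[OF c] by (auto simp: chart_dom_def)
  then show "smooth_on (chart_image c) (\<lambda>x. X (chart_inv c x) (\<lambda>q. snd c q \<bullet> b))"
    using smooth_fun_on_chart[OF field_smooth[OF X smooth_fun_on_chart_coordinate[OF c]] c, of b] by simp
qed

lemma field_in_chart:
  assumes "smooth_vector_field A X" "c \<in> A" "x \<in> chart_image c" "smooth_near A (chart_inv c x) f"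
  shows "X (chart_inv c x) f = FD (\<lambda>x. f (chart_inv c x)) x (chart_coords c (X (chart_inv c x)))"
  using tangent_vector_in_chart[OF assms(2) chart_inv_in[OF assms(2,3)] field_tangent[OF assms(1)]] assms(4)
  by (metis assms(2,3) chart_vector_def snd_chart_inv)

text \<open>
  The derivative of \<open>y \<mapsto> dF(y)(\<eta> y)\<close> splits into a first-order part and a second-order part. In a
  bracket only the first-order parts survive.
\<close>

lemma FD_FD_along:
  fixes F :: "'b::euclidean_space \<Rightarrow> real"
  assumes F: "smooth_on U F" "open U" "x \<in> U" and \<eta>: "\<eta> differentiable (at x)"
  shows "FD (\<lambda>y. FD F y (\<eta> y)) x w = FD F x (FD \<eta> x w) + (\<Sum>b\<in>Basis. (\<eta> x \<bullet> b) * FD (\<lambda>y. FD F y b) x w)"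
proof -
  have dF: "F differentiable (at y)" if "y \<in> U" for y using smooth_on_differentiable F that by blast
  have "((\<lambda>y. \<Sum>b\<in>Basis. (\<eta> y \<bullet> b) * FD F y b) has_derivative
     (\<lambda>w. \<Sum>b\<in>Basis. (\<eta> x \<bullet> b) * FD (\<lambda>y. FD F y b) x w + (FD \<eta> x w \<bullet> b) * FD F x b)) (at x)"
    by (intro has_derivative_sum has_derivative_mult has_derivative_inner_left FD_works \<eta>
        smooth_on_differentiable[OF smooth_on_FD[OF F(1)] F(3)])
  then have "((\<lambda>y. FD F y (\<eta> y)) has_derivative
     (\<lambda>w. \<Sum>b\<in>Basis. (\<eta> x \<bullet> b) * FD (\<lambda>y. FD F y b) x w + (FD \<eta> x w \<bullet> b) * FD F x b)) (at x)"
    by (rule has_derivative_transform_within_open[OF _ F(2,3)])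
      (use linear_expand_Basis[OF FD_linear[OF dF]] in simp)
  then show ?thesis
    using linear_expand_Basis[OF FD_linear[OF dF[OF F(3)]], of "FD \<eta> x w"]
    by (simp add: FD_eq sum.distrib)
qed

text \<open>
  The second-order parts of \<open>X(Y f)\<close> and \<open>Y(X f)\<close> are the second derivative of \<open>f\<close> evaluated at
  the coordinates of \<open>X\<close> and \<open>Y\<close> in either order. They cancel, which leaves a derivative of \<open>f\<close> in
  one direction; this is why the bracket takes values in the tangent spaces.
\<close>

lemma field_bracket_in_chart:
  assumes X: "smooth_vector_field A X" and Y: "smooth_vector_field A Y" and c: "c \<in> A" "p \<in> fst c"
  defines "\<xi> \<equiv> \<lambda>x. chart_coords c (X (chart_inv c x))" and "\<eta> \<equiv> \<lambda>x. chart_coords c (Y (chart_inv c x))"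
  shows "field_bracket A X Y p =
    chart_vector c p (FD \<eta> (snd c p) (\<xi> (snd c p)) - FD \<xi> (snd c p) (\<eta> (snd c p)))"
proof
  fix f
  let ?x = "snd c p"
  have x: "?x \<in> chart_image c" "chart_inv c ?x = p" using c by (simp_all add: snd_in_chart_image chart_inv_snd)
  show "field_bracket A X Y p f = chart_vector c p (FD \<eta> ?x (\<xi> ?x) - FD \<xi> ?x (\<eta> ?x)) f"
  proof (cases "smooth_near A p f")
    case True
    obtain U where U: "open U" "?x \<in> U" "U \<subseteq> chart_image c" "smooth_on U (\<lambda>x. f (chart_inv c x))"
      and near: "\<And>x. x \<in> U \<Longrightarrow> smooth_near A (chart_inv c x) f"
      using smooth_near_chart[OF True c] by blast
    define F where "F x = f (chart_inv c x)" for x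
    have F: "smooth_on U F" using U(4) by (simp add: F_def[abs_def])
    have iterate: "V p (\<lambda>q. Z q f) = FD F ?x (FD (\<lambda>x. chart_coords c (Z (chart_inv c x))) ?x (chart_coords c (V p)))
        + (\<Sum>b\<in>Basis. (chart_coords c (Z p) \<bullet> b) * FD (\<lambda>y. FD F y b) ?x (chart_coords c (V p)))"
      if V: "smooth_vector_field A V" and Z: "smooth_vector_field A Z" for V Z
    proof -
      let ?\<zeta> = "\<lambda>x. chart_coords c (Z (chart_inv c x))"
      have \<zeta>: "smooth_on (chart_image c) ?\<zeta>" by (rule smooth_field_coords[OF Z c(1)])
      have "V p (\<lambda>q. Z q f) = FD (\<lambda>x. Z (chart_inv c x) f) ?x (chart_coords c (V p))"
        using field_in_chart[OF V c(1) x(1), of "\<lambda>q. Z q f"] field_smooth_near[OF Z True] by (simp add: x)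
      also have "\<dots> = FD (\<lambda>x. FD F x (?\<zeta> x)) ?x (chart_coords c (V p))"
      proof -
        have "(\<lambda>x. Z (chart_inv c x) f) differentiable (at ?x)"
          by (rule smooth_near_differentiable[OF field_smooth_near[OF Z True] c])
        moreover have "Z (chart_inv c x) f = FD F x (?\<zeta> x)" if "x \<in> U" for x
          using field_in_chart[OF Z c(1) _ near[OF that]] that U(3) by (auto simp: F_def[abs_def])
        ultimately have "FD (\<lambda>x. Z (chart_inv c x) f) ?x = FD (\<lambda>x. FD F x (?\<zeta> x)) ?x"
          by (rule frechet_derivative_transform_within_open[OF _ U(1,2)])
        then show ?thesis by simp
      qed
      also have "\<dots> = FD F ?x (FD ?\<zeta> ?x (chart_coords c (V p)))
        + (\<Sum>b\<in>Basis. (?\<zeta> ?x \<bullet> b) * FD (\<lambda>y. FD F y b) ?x (chart_coords c (V p)))"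
        by (rule FD_FD_along[OF F U(1,2) smooth_on_differentiable[OF \<zeta> x(1)]])
      finally show ?thesis by (simp add: x)
    qed
    have dd: "linear (FD (\<lambda>y. FD F y b) ?x)" for b
      by (intro FD_linear smooth_on_differentiable[OF smooth_on_FD[OF F] U(2)])
    have sym: "(\<Sum>b\<in>Basis. (v \<bullet> b) * FD (\<lambda>y. FD F y b) ?x w) = (\<Sum>b\<in>Basis. (w \<bullet> b) * FD (\<lambda>y. FD F y b) ?x v)" for v w
    proof -
      have "(\<Sum>b\<in>Basis. (v \<bullet> b) * FD (\<lambda>y. FD F y b) ?x w)
         = (\<Sum>b\<in>Basis. \<Sum>a\<in>Basis. (v \<bullet> b) * ((w \<bullet> a) * FD (\<lambda>y. FD F y b) ?x a))"
        by (subst linear_expand_Basis[OF dd, of _ w]) (simp add: sum_distrib_left)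
      also have "\<dots> = (\<Sum>a\<in>Basis. \<Sum>b\<in>Basis. (v \<bullet> b) * ((w \<bullet> a) * FD (\<lambda>y. FD F y b) ?x a))"
        by (rule sum.swap)
      also have "\<dots> = (\<Sum>a\<in>Basis. \<Sum>b\<in>Basis. (w \<bullet> a) * ((v \<bullet> b) * FD (\<lambda>y. FD F y a) ?x b))"
        by (intro sum.cong refl) (simp add: FD_FD_commute[OF F U(1,2)])
      also have "\<dots> = (\<Sum>a\<in>Basis. (w \<bullet> a) * FD (\<lambda>y. FD F y a) ?x v)"
        by (simp add: linear_expand_Basis[OF dd, of _ v] sum_distrib_left)
      finally show ?thesis .
    qed
    have "linear (FD F ?x)" by (intro FD_linear smooth_on_differentiable[OF F U(2)])
    then show ?thesis
      using True sym[of "\<xi> ?x" "\<eta> ?x"]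
      by (simp add: field_bracket_def chart_vector_def iterate[OF X Y] iterate[OF Y X] \<xi>_def \<eta>_def x
          linear_diff F_def[symmetric])
  qed (simp add: field_bracket_def chart_vector_def)
qed

lemma smooth_field_bracket:
  assumes X: "smooth_vector_field A X" and Y: "smooth_vector_field A Y"
  shows "smooth_vector_field A (field_bracket A X Y)"
  unfolding smooth_vector_field_def
proof (safe)
  fix p
  obtain c where c: "c \<in> A" "p \<in> fst c" by (rule chart_covers)
  show "field_bracket A X Y p \<in> tangent_space A p"
    unfolding field_bracket_in_chart[OF X Y c] by (rule chart_vector_in_tangent_space[OF c])
next
  fix W f assume f: "smooth_fun_on A W f"
  have "smooth_fun_on A W (\<lambda>p. X p (\<lambda>q. Y q f) - Y p (\<lambda>q. X q f))"
    by (rule smooth_fun_on_diff[OF field_smooth[OF X field_smooth[OF Y f]]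
          field_smooth[OF Y field_smooth[OF X f]]])
  then show "smooth_fun_on A W (\<lambda>p. field_bracket A X Y p f)"
    by (rule smooth_fun_on_cong) (use smooth_nearI[OF f] in \<open>simp add: field_bracket_def\<close>)
qed

end

section \<open>Left translations and left-invariant fields\<close>

lemma left_push_left_push:
  fixes a b :: "'g::group_add"
  shows "left_push a (left_push b u) = left_push (a + b) u"
  by (simp add: left_push_def add.assoc)

lemma left_push_zero [simp]: "left_push (0::'g::group_add) u = u"
  by (simp add: left_push_def)

locale lie_group_manifold =
  fixes A :: "('g::{topological_group_add, t2_space, second_countable_topology},
               'e::euclidean_space) chart set"
  assumes lie: "lie_group A"

sublocale lie_group_manifold \<subseteq> manifold A
  using lie by unfold_locales (simp add: lie_group_def)

context lie_group_manifold
begin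

lemma smooth_mult_in_charts:
  assumes "c \<in> A" "d \<in> A" "e \<in> A"
  shows "smooth_on {(x, y). x \<in> chart_image c \<and> y \<in> chart_image d \<and> chart_inv c x + chart_inv d y \<in> fst e}
    (\<lambda>(x, y). snd e (chart_inv c x + chart_inv d y))"
  using lie assms unfolding lie_group_def by blast

lemma open_mult_in_charts:
  assumes "c \<in> A" "d \<in> A" "e \<in> A"
  shows "open {(x, y). x \<in> chart_image c \<and> y \<in> chart_image d \<and> chart_inv c x + chart_inv d y \<in> fst e}"
proof -
  have "continuous_on (chart_image c \<times> chart_image d) (\<lambda>z. chart_inv c (fst z) + chart_inv d (snd z))"
    by (intro continuous_on_add continuous_on_compose2[OF continuous_chart_inv] continuous_intros assms) auto
  then have "open ((chart_image c \<times> chart_image d) \<inter> (\<lambda>z. chart_inv c (fst z) + chart_inv d (snd z)) -` fst e)"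
    by (rule continuous_open_preimage)
      (simp_all only: open_Times chart_open assms)
  also have "?this \<longleftrightarrow> ?thesis" by (rule arg_cong[where f = "open"]) auto
  finally show ?thesis .
qed

lemma smooth_fun_mult_in_charts:
  assumes c: "c \<in> A" "p \<in> fst c" and d: "d \<in> A" "q \<in> fst d" and f: "smooth_near A (p + q) f"
  obtains \<Omega> where "open \<Omega>" "(snd c p, snd d q) \<in> \<Omega>" "\<Omega> \<subseteq> chart_image c \<times> chart_image d"
    "smooth_on \<Omega> (\<lambda>(x, y). f (chart_inv c x + chart_inv d y))"
proof -
  obtain e where e: "e \<in> A" "p + q \<in> fst e" by (rule chart_covers)
  obtain U where U: "open U" "snd e (p + q) \<in> U" "smooth_on U (\<lambda>x. f (chart_inv e x))"
    by (rule smooth_near_chart[OF f e]) (rule that)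
  let ?M = "\<lambda>(x, y). snd e (chart_inv c x + chart_inv d y)"
  let ?S = "{(x, y). x \<in> chart_image c \<and> y \<in> chart_image d \<and> chart_inv c x + chart_inv d y \<in> fst e}"
  note M = smooth_mult_in_charts[OF c(1) d(1) e(1)]
  define \<Omega> where "\<Omega> = ?S \<inter> ?M -` U"
  have op: "open \<Omega>" unfolding \<Omega>_def
    by (rule continuous_open_preimage[OF smooth_on_continuous[OF M] open_mult_in_charts U(1)]) fact+
  show ?thesis
  proof (rule that[OF op])
    show "(snd c p, snd d q) \<in> \<Omega>"
      using c d e U by (simp add: \<Omega>_def chart_inv_snd snd_in_chart_image)
    show "\<Omega> \<subseteq> chart_image c \<times> chart_image d" by (auto simp: \<Omega>_def)
    show "smooth_on \<Omega> (\<lambda>(x, y). f (chart_inv c x + chart_inv d y))"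
    proof (rule smooth_on_cong[OF smooth_on_compose[OF U(3,1) smooth_on_subset[OF M] op] op])
      show "((\<lambda>x. f (chart_inv e x)) \<circ> ?M) z = (case z of (x, y) \<Rightarrow> f (chart_inv c x + chart_inv d y))"
        if "z \<in> \<Omega>" for z
        using that by (auto simp: \<Omega>_def chart_inv_snd e(1))
    qed (auto simp: \<Omega>_def)
  qed
qed

lemma smooth_fun_left_difference_in_charts:
  assumes c: "c \<in> A" "p \<in> fst c" and d: "d \<in> A" "q \<in> fst d" and f: "smooth_near A (- p + q) f"
  obtains \<Omega> where "open \<Omega>" "(snd c p, snd d q) \<in> \<Omega>" "\<Omega> \<subseteq> chart_image c \<times> chart_image d"
    "smooth_on \<Omega> (\<lambda>(x, y). f (- chart_inv c x + chart_inv d y))"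
proof -
  obtain e where e: "e \<in> A" "- p \<in> fst e" by (rule chart_covers)
  obtain \<Omega>' where \<Omega>': "open \<Omega>'" "(snd e (- p), snd d q) \<in> \<Omega>'" "\<Omega>' \<subseteq> chart_image e \<times> chart_image d"
    "smooth_on \<Omega>' (\<lambda>(x, y). f (chart_inv e x + chart_inv d y))"
    by (rule smooth_fun_mult_in_charts[OF e d f])
  let ?S = "{x. x \<in> chart_image c \<and> - chart_inv c x \<in> fst e}"
  let ?N = "\<lambda>x. snd e (- chart_inv c x)"
  have N: "smooth_on ?S ?N" using lie c e unfolding lie_group_def by blast
  have "continuous_on (chart_image c) (\<lambda>x. - chart_inv c x)"
    by (intro continuous_on_minus continuous_chart_inv c)
  then have S: "open ?S"
    using continuous_open_preimage[OF _ chart_open(2)[OF c(1)] chart_open(1)[OF e(1)]]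
    by (simp add: Int_def vimage_def)
  have N2: "smooth_on (?S \<times> UNIV) (\<lambda>z. (?N (fst z), snd z))"
  proof (intro smooth_on_Pair open_Times S open_UNIV smooth_on_bounded_linear[OF bounded_linear_snd])
    show "smooth_on (?S \<times> UNIV) (\<lambda>z. ?N (fst z))"
      using smooth_on_compose[OF N S smooth_on_bounded_linear[OF bounded_linear_fst] open_Times[OF S open_UNIV]]
      by (auto simp: comp_def)
  qed
  define \<Omega> where "\<Omega> = (?S \<times> chart_image d) \<inter> (\<lambda>z. (?N (fst z), snd z)) -` \<Omega>'"
  have op: "open \<Omega>" unfolding \<Omega>_def
    by (rule continuous_open_preimage[OF _ _ \<Omega>'(1)])
     (rule smooth_on_continuous[OF smooth_on_subset[OF N2]], auto intro: open_Times S chart_open d)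
  show ?thesis
  proof (rule that[OF op])
    show "(snd c p, snd d q) \<in> \<Omega>"
      using c d e \<Omega>' by (simp add: \<Omega>_def chart_inv_snd snd_in_chart_image)
    show "\<Omega> \<subseteq> chart_image c \<times> chart_image d" by (auto simp: \<Omega>_def)
    show "smooth_on \<Omega> (\<lambda>(x, y). f (- chart_inv c x + chart_inv d y))"
    proof (rule smooth_on_cong[OF smooth_on_compose[OF \<Omega>'(4,1) smooth_on_subset[OF N2] op] op])
      show "((\<lambda>(x, y). f (chart_inv e x + chart_inv d y)) \<circ> (\<lambda>z. (?N (fst z), snd z))) z
          = (case z of (x, y) \<Rightarrow> f (- chart_inv c x + chart_inv d y))"
        if "z \<in> \<Omega>" for z
        using that by (auto simp: \<Omega>_def chart_inv_snd e(1))
    qed (auto simp: \<Omega>_def)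
  qed
qed

lemma smooth_near_translate_imp:
  assumes f: "smooth_near A (a + p) f" shows "smooth_near A p (\<lambda>x. f (a + x))"
proof -
  obtain c where c: "c \<in> A" "a \<in> fst c" by (rule chart_covers)
  obtain d where d: "d \<in> A" "p \<in> fst d" by (rule chart_covers)
  obtain \<Omega> where \<Omega>: "open \<Omega>" "(snd c a, snd d p) \<in> \<Omega>" "\<Omega> \<subseteq> chart_image c \<times> chart_image d"
    "smooth_on \<Omega> (\<lambda>(x, y). f (chart_inv c x + chart_inv d y))"
    by (rule smooth_fun_mult_in_charts[OF c d f])
  define U where "U = Pair (snd c a) -` \<Omega>"
  have U: "open U" unfolding U_def
    by (rule open_vimage[OF \<Omega>(1)]) (intro continuous_intros)
  show ?thesis
  proof (rule smooth_nearI_chart[OF d U])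
    show "snd d p \<in> U" "U \<subseteq> chart_image d" using \<Omega>(2,3) by (auto simp: U_def)
    have "smooth_on U ((\<lambda>(x, y). f (chart_inv c x + chart_inv d y)) \<circ> Pair (snd c a))"
      by (rule smooth_on_compose[OF \<Omega>(4,1) smooth_on_Pair[OF U smooth_on_const smooth_on_ident] U])
        (auto simp: U_def)
    then show "smooth_on U (\<lambda>x. f (a + chart_inv d x))" using c by (simp add: comp_def chart_inv_snd)
  qed
qed

text \<open>
  An equivalence is needed because tangent vectors vanish on functions that are not smooth near
  the point: a translated vector has to vanish on exactly the right functions.
\<close>

lemma smooth_near_translate: "smooth_near A p (\<lambda>x. f (a + x)) \<longleftrightarrow> smooth_near A (a + p) f"
proof
  assume "smooth_near A p (\<lambda>x. f (a + x))"
  then have "smooth_near A (- a + (a + p)) (\<lambda>x. f (a + x))" by (simp add: add.assoc[symmetric])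
  from smooth_near_translate_imp[OF this] show "smooth_near A (a + p) f"
    by (simp add: add.assoc[symmetric])
qed (rule smooth_near_translate_imp)

text \<open>
  The coordinates of the translated vector are obtained from those of \<open>u\<close> by the derivative of the
  translation read in charts, called \<open>M\<close> in the proof.
\<close>

lemma left_push_tangent:
  assumes u: "u \<in> tangent_space A p"
  shows "left_push a u \<in> tangent_space A (a + p)"
proof -
  obtain c where c: "c \<in> A" "a \<in> fst c" by (rule chart_covers)
  obtain d where d: "d \<in> A" "p \<in> fst d" by (rule chart_covers)
  obtain e where e: "e \<in> A" "a + p \<in> fst e" by (rule chart_covers)
  obtain v where u: "u = chart_vector d p v" using u by (auto simp: tangent_space_eq[OF d])
  define M where "M y = snd e (a + chart_inv d y)" for y
  have "(\<lambda>y. case (snd c a, y) of (x, y) \<Rightarrow> snd e (chart_inv c x + chart_inv d y))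
      differentiable (at (snd d p))"
    by (rule FD_partial_snd(1)[OF smooth_on_differentiable[OF smooth_mult_in_charts[OF c(1) d(1) e(1)]]])
      (use c d e in \<open>simp add: chart_inv_snd snd_in_chart_image\<close>)
  then have M: "(M has_derivative FD M (snd d p)) (at (snd d p))"
    using c by (intro FD_works) (simp add: M_def[abs_def] chart_inv_snd)
  have "left_push a u = chart_vector e (a + p) (FD M (snd d p) v)"
  proof
    fix f
    show "left_push a u f = chart_vector e (a + p) (FD M (snd d p) v) f"
    proof (cases "smooth_near A (a + p) f")
      case True
      let ?f = "\<lambda>x. f (chart_inv e x)"
      have Mp: "M (snd d p) = snd e (a + p)" using d by (simp add: M_def chart_inv_snd)
      have "(?f has_derivative FD ?f (M (snd d p))) (at (M (snd d p)))"
        unfolding Mp by (intro FD_works smooth_near_differentiable True e)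
      from diff_chain_at[OF M this]
      have "((?f \<circ> M) has_derivative (FD ?f (M (snd d p)) \<circ> FD M (snd d p))) (at (snd d p))" .
      then have "((\<lambda>y. f (a + chart_inv d y)) has_derivative (FD ?f (M (snd d p)) \<circ> FD M (snd d p))) (at (snd d p))"
      proof (rule has_derivative_transform_within_open)
        have "continuous_on (chart_image d) (\<lambda>x. a + chart_inv d x)"
          by (intro continuous_on_add continuous_on_const continuous_chart_inv d)
        then show "open (chart_image d \<inter> (\<lambda>x. a + chart_inv d x) -` fst e)"
          using continuous_open_preimage chart_open d e by blast
      qed (use d e in \<open>auto simp: M_def chart_inv_snd snd_in_chart_image\<close>)
      then show ?thesis
        using True by (simp add: u left_push_def chart_vector_def smooth_near_translate FD_eq Mp)
    qed (simp add: u left_push_def chart_vector_def smooth_near_translate)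
  qed
  then show ?thesis using chart_vector_in_tangent_space[OF e] by simp
qed

lemma left_push_back_tangent: "u \<in> tangent_space A p \<Longrightarrow> left_push (- p) u \<in> tangent_space A 0"
  using left_push_tangent[of u p "- p"] by simp

text \<open>The vector \<open>u\<close> is meant to be tangent at the neutral element.\<close>

definition left_extension :: "'g tangent_vector \<Rightarrow> 'g vector_field" where
  "left_extension u p = left_push p u"

text \<open>
  In charts, the value of the field on \<open>f\<close> at \<open>p\<close> is the derivative of \<open>(p, q) \<mapsto> f (p + q)\<close> in the
  second variable at \<open>q = 0\<close>, which depends smoothly on \<open>p\<close> since the group operation is smooth.
\<close>

lemma smooth_left_extension:
  assumes u: "u \<in> tangent_space A 0"
  shows "smooth_vector_field A (left_extension u)"
  unfolding smooth_vector_field_def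
proof (safe)
  show "left_extension u p \<in> tangent_space A p" for p
    using left_push_tangent[OF u, of p] by (simp add: left_extension_def)
  fix W f assume f: "smooth_fun_on A W f"
  show "smooth_fun_on A W (\<lambda>p. left_extension u p f)"
  proof (rule smooth_fun_on_local)
    show "open W" using f by (simp add: smooth_fun_on_iff)
    fix p assume p: "p \<in> W"
    obtain c where c: "c \<in> A" "p \<in> fst c" by (rule chart_covers)
    obtain d where d: "d \<in> A" "0 \<in> fst d" by (rule chart_covers)
    obtain v where v: "u = chart_vector d 0 v" using u by (auto simp: tangent_space_eq[OF d])
    have "smooth_near A (p + 0) f" using smooth_nearI[OF f p] by simp
    then obtain \<Omega> where \<Omega>: "open \<Omega>" "(snd c p, snd d 0) \<in> \<Omega>" "\<Omega> \<subseteq> chart_image c \<times> chart_image d"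
      "smooth_on \<Omega> (\<lambda>(x, y). f (chart_inv c x + chart_inv d y))"
      by (rule smooth_fun_mult_in_charts[OF c d])
    define U where "U = (\<lambda>x. (x, snd d 0)) -` \<Omega> \<inter> chart_dom c W"
    have U: "open U" unfolding U_def
      by (intro open_Int open_chart_dom c \<open>open W\<close> open_vimage[OF \<Omega>(1)] continuous_intros)
    show "smooth_near A p (\<lambda>p. left_extension u p f)"
    proof (rule smooth_nearI_chart[OF c U])
      show "snd c p \<in> U" "U \<subseteq> chart_image c"
        using \<Omega>(2) p snd_in_chart_dom[OF c p] by (auto simp: U_def chart_dom_def)
      have "smooth_on U (\<lambda>x. FD (\<lambda>y. case (x, y) of (x, y) \<Rightarrow> f (chart_inv c x + chart_inv d y)) (snd d 0) v)"
        by (rule smooth_on_partial_snd[OF \<Omega>(4,1) U smooth_on_const smooth_on_const]) (simp add: U_def)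
      then show "smooth_on U (\<lambda>x. left_extension u (chart_inv c x) f)"
      proof (rule smooth_on_cong[OF _ U])
        fix x assume "x \<in> U"
        then have "chart_inv c x \<in> W" by (simp add: U_def chart_dom_def)
        then have "smooth_near A 0 (\<lambda>y. f (chart_inv c x + y))"
          using smooth_nearI[OF f] by (simp add: smooth_near_translate)
        then show "FD (\<lambda>y. case (x, y) of (x, y) \<Rightarrow> f (chart_inv c x + chart_inv d y)) (snd d 0) v
            = left_extension u (chart_inv c x) f"
          by (simp add: left_extension_def left_push_def v chart_vector_def)
      qed
    qed
  qed
qed

lemma left_extension_invariant:
  assumes "u \<in> tangent_space A 0" shows "left_extension u \<in> left_invariant_fields A"
  using smooth_left_extension[OF assms]
  by (simp add: left_invariant_fields_def left_extension_def left_push_left_push)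

lemma field_bracket_left_invariant:
  assumes "X \<in> left_invariant_fields A" "Y \<in> left_invariant_fields A"
  shows "field_bracket A X Y \<in> left_invariant_fields A"
proof -
  have X: "smooth_vector_field A X" "\<And>a p f. X (a + p) f = X p (\<lambda>x. f (a + x))"
    and Y: "smooth_vector_field A Y" "\<And>a p f. Y (a + p) f = Y p (\<lambda>x. f (a + x))"
    using assms by (simp_all add: left_invariant_fields_def left_push_def)
  show ?thesis
    using smooth_field_bracket[OF X(1) Y(1)]
    by (auto simp: left_invariant_fields_def left_push_def field_bracket_def fun_eq_iff
        smooth_near_translate X(2) Y(2))
qed

text \<open>
  The bracket and the zero field are both left-invariant, and \<open>\<Phi>\<close> sends both to 0, so they agree by
  injectivity.
\<close>

lemma field_bracket_left_invariant_eq_0: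
  assumes L: "has_lie_algebra A br" and br: "\<And>x y. br x y = 0"
    and XY: "X \<in> left_invariant_fields A" "Y \<in> left_invariant_fields A"
  shows "field_bracket A X Y = (\<lambda>p f. 0)"
proof -
  obtain \<Phi> where inj: "inj_on \<Phi> (left_invariant_fields A)"
    and \<Phi>br: "\<And>X Y. X \<in> left_invariant_fields A \<Longrightarrow> Y \<in> left_invariant_fields A \<Longrightarrow>
      \<Phi> (field_bracket A X Y) = br (\<Phi> X) (\<Phi> Y)"
    and \<Phi>sc: "\<And>X r. X \<in> left_invariant_fields A \<Longrightarrow> \<Phi> (field_mult (\<lambda>_. r) X) = r *\<^sub>R \<Phi> X"
    using L unfolding has_lie_algebra_def bij_betw_def by blast
  have zero: "field_mult (\<lambda>_. 0) X = (\<lambda>p f. 0)" for X :: "'g vector_field"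
    by (simp add: field_mult_def)
  have "left_extension (\<lambda>f. 0) = (\<lambda>p f. 0)" by (simp add: left_extension_def fun_eq_iff left_push_def)
  then have "(\<lambda>p f. 0) \<in> left_invariant_fields A"
    using left_extension_invariant[OF tangent_zero] by simp
  moreover have "\<Phi> (field_bracket A X Y) = \<Phi> (\<lambda>p f. 0)"
    using \<Phi>sc[OF XY(1), of 0] \<Phi>br[OF XY] br zero by simp
  ultimately show ?thesis
    using inj field_bracket_left_invariant[OF XY] by (meson inj_onD)
qed

section \<open>Existence of a left-invariant metric\<close>

text \<open>
  The inner product of \<open>u\<close> and \<open>v\<close> at \<open>p\<close> is the Euclidean one of the coordinates, in a chart at the
  neutral element, of the vectors translated there by \<open>- p\<close>. Its smoothness is that of
  \<open>(p, q) \<mapsto> - p + q\<close> in charts, differentiated in \<open>q\<close> on the diagonal.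
\<close>

lemma left_invariant_metric_exists:
  "\<exists>g. riemannian_metric A g \<and> left_invariant2 A g"
proof -
  obtain c where c: "c \<in> A" "0 \<in> fst c" by (rule chart_covers)
  \<comment> \<open>\<open>\<theta> b\<close> is the left-invariant 1-form that extends the coordinate form \<open>dx\<^sub>b\<close> at the neutral
      element.\<close>
  define \<theta> :: "'e \<Rightarrow> 'g \<Rightarrow> 'g tangent_vector \<Rightarrow> real"
    where "\<theta> b p u = u (\<lambda>x. snd c (- p + x) \<bullet> b)" for b p u
  define g :: "'g tensor2" where "g p u v = (\<Sum>b\<in>Basis. \<theta> b p u * \<theta> b p v)" for p u v
  have smooth_\<theta>: "smooth_fun_on A UNIV (\<lambda>p. \<theta> b p (X p))" if X: "smooth_vector_field A X" for b X
  proof (rule smooth_fun_on_local[OF open_UNIV])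
    fix p
    let ?f = "\<lambda>q. snd c q \<bullet> b"
    have f0: "smooth_near A 0 ?f"
      by (rule smooth_nearI[OF smooth_fun_on_chart_coordinate[OF c(1)] c(2)])
    obtain d where d: "d \<in> A" "p \<in> fst d" by (rule chart_covers)
    have "smooth_near A (- p + p) ?f" using f0 by simp
    then obtain \<Omega> where \<Omega>: "open \<Omega>" "(snd d p, snd d p) \<in> \<Omega>" "\<Omega> \<subseteq> chart_image d \<times> chart_image d"
      "smooth_on \<Omega> (\<lambda>(x, y). ?f (- chart_inv d x + chart_inv d y))"
      by (rule smooth_fun_left_difference_in_charts[OF d d])
    define U where "U = (\<lambda>x. (x, x)) -` \<Omega>"
    have U: "open U" unfolding U_def by (intro open_vimage[OF \<Omega>(1)] continuous_intros)
    have Ud: "U \<subseteq> chart_image d" using \<Omega>(3) by (auto simp: U_def)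
    show "smooth_near A p (\<lambda>p. \<theta> b p (X p))"
    proof (rule smooth_nearI_chart[OF d U _ Ud])
      show "snd d p \<in> U" using \<Omega>(2) by (simp add: U_def)
      have "smooth_on U (\<lambda>x. FD (\<lambda>y. case (x, y) of (x, y) \<Rightarrow> ?f (- chart_inv d x + chart_inv d y)) x
          (chart_coords d (X (chart_inv d x))))"
        by (rule smooth_on_partial_snd[OF \<Omega>(4,1) U smooth_on_ident
              smooth_on_subset[OF smooth_field_coords[OF X d(1)] Ud]]) (simp add: U_def)
      then show "smooth_on U (\<lambda>x. \<theta> b (chart_inv d x) (X (chart_inv d x)))"
      proof (rule smooth_on_cong[OF _ U])
        fix x assume "x \<in> U"
        then have x: "x \<in> chart_image d" using Ud by blast
        have near: "smooth_near A (chart_inv d x) (\<lambda>q. ?f (- chart_inv d x + q))"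
          using f0 by (simp add: smooth_near_translate[of _ ?f])
        show "FD (\<lambda>y. case (x, y) of (x, y) \<Rightarrow> ?f (- chart_inv d x + chart_inv d y)) x
          (chart_coords d (X (chart_inv d x))) = \<theta> b (chart_inv d x) (X (chart_inv d x))"
          using field_in_chart[OF X d(1) x near] by (simp add: \<theta>_def)
      qed
    qed
  qed
  have tensor: "tensor_field2 A g"
    unfolding tensor_field2_def
  proof (intro conjI allI ballI impI)
    show "smooth_fun_on A UNIV (\<lambda>p. g p (X p) (Y p))"
      if "smooth_vector_field A X" "smooth_vector_field A Y" for X Y
      unfolding g_def by (intro smooth_fun_on_sum smooth_fun_on_mult smooth_\<theta> that open_UNIV)
  qed (simp_all add: g_def \<theta>_def algebra_simps sum.distrib sum_distrib_left)
  have pos: "g p u u > 0" if u: "u \<in> tangent_space A p" and "u \<noteq> (\<lambda>_. 0)" for p u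
  proof -
    let ?w = "left_push (- p) u"
    have w: "?w \<in> tangent_space A 0" by (rule left_push_back_tangent[OF u])
    have "?w \<noteq> (\<lambda>_. 0)"
    proof
      assume "?w = (\<lambda>_. 0)"
      then have "left_push p ?w = (\<lambda>_. 0)" by (simp add: left_push_def)
      then show False using that by (simp add: left_push_left_push)
    qed
    then have "chart_coords c ?w \<noteq> 0"
      using tangent_vector_in_chart[OF c w] chart_vector_combination[OF c, of 0 _ 0] by force
    moreover have "?w (\<lambda>q. snd c q \<bullet> b) = \<theta> b p u" for b by (simp add: left_push_def \<theta>_def)
    ultimately have "(\<Sum>b\<in>Basis. \<theta> b p u *\<^sub>R b) \<noteq> 0" by (simp add: chart_coords_def)
    then obtain b :: 'e where "b \<in> Basis" "\<theta> b p u \<noteq> 0"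
      by (metis (mono_tags, lifting) scaleR_eq_0_iff sum.neutral)
    then show ?thesis
      unfolding g_def by (intro sum_pos2[of Basis b]) (auto simp: zero_less_mult_iff linorder_neq_iff)
  qed
  have inv: "left_invariant2 A g"
  proof -
    have "- (a + p) + (a + x) = - p + x" for a p x :: 'g
      by (simp only: minus_add add.assoc minus_add_cancel)
    then show ?thesis by (simp only: left_invariant2_def g_def \<theta>_def left_push_def) simp
  qed
  have "symmetric_tensor_field2 A g"
    using tensor by (simp add: symmetric_tensor_field2_def g_def mult.commute)
  then show ?thesis using pos inv by (auto simp: riemannian_metric_def)
qed

end

section \<open>Left-invariant orthonormal frames\<close>

text \<open>
  An orthonormal set is independent, so its size is bounded by the dimension and a largest one
  exists. It spans: otherwise the normalised remainder of some vector would enlarge it.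
\<close>

lemma orthonormal_expansion_exists:
  fixes \<beta> :: "'e::euclidean_space \<Rightarrow> 'e \<Rightarrow> real"
  assumes lin: "\<And>w. linear (\<lambda>v. \<beta> v w)" and sym: "\<And>v w. \<beta> v w = \<beta> w v"
    and pos: "\<And>v. v \<noteq> 0 \<Longrightarrow> \<beta> v v > 0"
  obtains B where "finite B" "\<And>a b. a \<in> B \<Longrightarrow> b \<in> B \<Longrightarrow> \<beta> a b = (if a = b then 1 else 0)"
    "\<And>v. v = (\<Sum>b\<in>B. \<beta> v b *\<^sub>R b)"
proof -
  define ON where "ON B \<longleftrightarrow> finite B \<and> (\<forall>a\<in>B. \<forall>b\<in>B. \<beta> a b = (if a = b then 1 else 0))" for B
  have \<beta>_sum: "\<beta> (\<Sum>b\<in>B. r b *\<^sub>R b) a = (\<Sum>b\<in>B. r b * \<beta> b a)" for r B a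
    by (simp add: linear_sum[OF lin] linear_cmul[OF lin])
  have coeff: "\<beta> (\<Sum>b\<in>B. r b *\<^sub>R b) a = r a" if "ON B" "a \<in> B" for r B a
  proof -
    have "(\<Sum>b\<in>B. r b * \<beta> b a) = (\<Sum>b\<in>B. if b = a then r b else 0)"
      using that by (intro sum.cong) (auto simp: ON_def)
    then show ?thesis using that by (simp add: \<beta>_sum ON_def)
  qed
  have card: "card B \<le> DIM('e)" if B: "ON B" for B
  proof -
    have "independent B"
    proof (rule independent_if_scalars_zero)
      show "finite B" using B by (simp add: ON_def)
      fix r b assume "(\<Sum>x\<in>B. r x *\<^sub>R x) = 0" "b \<in> B"
      then show "r b = 0" using coeff[OF B, of b r] linear_0[OF lin] by simp
    qed
    then show ?thesis by (rule independent_card_le)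
  qed
  have "ON {}" by (simp add: ON_def)
  then obtain B where B: "ON B" and max: "\<And>C. ON C \<Longrightarrow> card C \<le> card B"
    using ex_has_greatest_nat[of ON "{}" card "Suc DIM('e)"] card by (auto simp: less_Suc_eq_le)
  have "v = (\<Sum>b\<in>B. \<beta> v b *\<^sub>R b)" for v
  proof (rule ccontr)
    assume neq: "v \<noteq> (\<Sum>b\<in>B. \<beta> v b *\<^sub>R b)"
    define r where "r = v - (\<Sum>b\<in>B. \<beta> v b *\<^sub>R b)"
    define e where "e = (1 / sqrt (\<beta> r r)) *\<^sub>R r"
    have r: "\<beta> r r > 0" using neq by (intro pos) (simp add: r_def)
    have rb: "\<beta> r b = 0" if "b \<in> B" for b
      using coeff[OF B that] linear_diff[OF lin[of b]] by (simp add: r_def)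
    have eb: "\<beta> e b = 0" if "b \<in> B" for b
      using linear_cmul[OF lin[of b]] rb[OF that] by (simp add: e_def)
    have "\<beta> e e = (1 / sqrt (\<beta> r r)) * \<beta> r e" using linear_cmul[OF lin[of e]] by (simp add: e_def)
    also have "\<beta> r e = (1 / sqrt (\<beta> r r)) * \<beta> r r"
      using linear_cmul[OF lin[of r]] sym[of r e] by (simp add: e_def)
    finally have ee: "\<beta> e e = 1" using r by (simp add: real_sqrt_mult_self)
    then have "e \<notin> B" using eb by fastforce
    moreover have "ON (insert e B)" using B ee eb sym by (auto simp: ON_def)
    moreover have "finite B" using B by (simp add: ON_def)
    ultimately show False using max[of "insert e B"] by simp
  qed
  then show ?thesis using B that by (auto simp: ON_def)
qed

locale left_invariant_metric = lie_group_manifold A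
  for A :: "('g::{topological_group_add, t2_space, second_countable_topology},
               'e::euclidean_space) chart set" +
  fixes g :: "'g tensor2"
  assumes metric: "riemannian_metric A g" and invariant: "left_invariant2 A g"
begin

lemma g_tensor: "symmetric_tensor_field2 A g" "tensor_field2 A g"
  using metric by (simp_all add: riemannian_metric_def symmetric_tensor_field2_def)

lemma g_combination:
  "u \<in> tangent_space A p \<Longrightarrow> v \<in> tangent_space A p \<Longrightarrow> w \<in> tangent_space A p \<Longrightarrow>
    g p (\<lambda>f. r * u f + s * v f) w = r * g p u w + s * g p v w"
  using g_tensor(2) unfolding tensor_field2_def by blast

lemma g_sym: "u \<in> tangent_space A p \<Longrightarrow> v \<in> tangent_space A p \<Longrightarrow> g p u v = g p v u"
  using g_tensor(1) unfolding symmetric_tensor_field2_def by blast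

lemma g_zero: "w \<in> tangent_space A p \<Longrightarrow> g p (\<lambda>f. 0) w = 0"
  using g_combination[of "\<lambda>f. 0" p "\<lambda>f. 0" w 0 0] by (simp add: tangent_zero)

lemma g_add:
  "u \<in> tangent_space A p \<Longrightarrow> v \<in> tangent_space A p \<Longrightarrow> w \<in> tangent_space A p \<Longrightarrow>
    g p (\<lambda>f. u f + v f) w = g p u w + g p v w"
  using g_combination[of u p v w 1 1] by simp

lemma g_scale:
  "u \<in> tangent_space A p \<Longrightarrow> w \<in> tangent_space A p \<Longrightarrow> g p (\<lambda>f. r * u f) w = r * g p u w"
  using g_combination[of u p u w r 0] by simp

lemma g_diff:
  "u \<in> tangent_space A p \<Longrightarrow> v \<in> tangent_space A p \<Longrightarrow> w \<in> tangent_space A p \<Longrightarrow>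
    g p (\<lambda>f. u f - v f) w = g p u w - g p v w"
  using g_combination[of u p v w 1 "-1"] by simp

lemma g_sum:
  assumes "w \<in> tangent_space A p" "\<And>i. i \<in> I \<Longrightarrow> u i \<in> tangent_space A p"
  shows "g p (\<lambda>f. \<Sum>i\<in>I. r i * u i f) w = (\<Sum>i\<in>I. r i * g p (u i) w)"
  using assms(2)
proof (induction I rule: infinite_finite_induct)
  case (insert i I)
  then have "u i \<in> tangent_space A p" "(\<lambda>f. \<Sum>i\<in>I. r i * u i f) \<in> tangent_space A p"
    by (auto intro: tangent_sum)
  then show ?case
    using g_combination[of "u i" p "\<lambda>f. \<Sum>i\<in>I. r i * u i f" w "r i" 1] assms(1) insert by simp
qed (simp_all add: g_zero assms(1))

lemma g_push:
  "u \<in> tangent_space A p \<Longrightarrow> v \<in> tangent_space A p \<Longrightarrow>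
    g (a + p) (left_push a u) (left_push a v) = g p u v"
  using invariant unfolding left_invariant2_def by blast

lemma g_smooth:
  "smooth_vector_field A X \<Longrightarrow> smooth_vector_field A Y \<Longrightarrow> smooth_fun_on A UNIV (\<lambda>p. g p (X p) (Y p))"
  using g_tensor(2) unfolding tensor_field2_def by blast

text \<open>
  The expansion with respect to an orthonormal basis at the neutral element is carried to every
  other point by left translation, which is an isometry.
\<close>

lemma orthonormal_frame_exists:
  obtains B :: "'e set" and E where "finite B" "\<And>b. E b \<in> left_invariant_fields A"
    "\<And>a b p. a \<in> B \<Longrightarrow> b \<in> B \<Longrightarrow> g p (E a p) (E b p) = (if a = b then 1 else 0)"
    "\<And>p u. u \<in> tangent_space A p \<Longrightarrow> u = (\<lambda>f. \<Sum>b\<in>B. g p u (E b p) * E b p f)"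
proof -
  obtain c where c: "c \<in> A" "0 \<in> fst c" by (rule chart_covers)
  let ?v = "chart_vector c 0"
  define \<beta> where "\<beta> v w = g 0 (?v v) (?v w)" for v w
  have T: "?v v \<in> tangent_space A 0" for v by (rule chart_vector_in_tangent_space[OF c])
  have "\<beta> (r *\<^sub>R v + s *\<^sub>R w) x = r * \<beta> v x + s * \<beta> w x" for r s v w x
    using g_combination[OF T T T] by (simp add: \<beta>_def chart_vector_combination[OF c, symmetric])
  from this[of 1 _ 1] this[of _ _ 0 0]
  have lin: "linear (\<lambda>v. \<beta> v w)" for w by (auto intro!: linearI)
  have sym: "\<beta> v w = \<beta> w v" for v w unfolding \<beta>_def by (rule g_sym[OF T T])
  have pos: "\<beta> v v > 0" if "v \<noteq> 0" for v
  proof -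
    have "?v v \<noteq> (\<lambda>_. 0)"
      using that chart_coords_chart_vector[OF c, of v] by (auto simp: chart_coords_def)
    then show ?thesis using metric T unfolding \<beta>_def riemannian_metric_def by blast
  qed
  obtain B where B: "finite B" "\<And>a b. a \<in> B \<Longrightarrow> b \<in> B \<Longrightarrow> \<beta> a b = (if a = b then 1 else 0)"
    and exp: "\<And>v. v = (\<Sum>b\<in>B. \<beta> v b *\<^sub>R b)"
    using orthonormal_expansion_exists[OF lin sym pos] by blast
  define E where "E b = left_extension (?v b)" for b
  have Ep: "E b p = left_push p (?v b)" for b p by (simp add: E_def left_extension_def)
  have vsum: "?v (\<Sum>b\<in>I. r b *\<^sub>R b) = (\<lambda>f. \<Sum>b\<in>I. r b * ?v b f)" if "finite I" for r I
    using that
  proof (induction I rule: finite_induct)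
    case empty
    then show ?case using chart_vector_combination[OF c, of 0 0 0 0] by simp
  next
    case (insert b I)
    then show ?case
      using chart_vector_combination[OF c, of "r b" b 1 "\<Sum>b\<in>I. r b *\<^sub>R b"] by simp
  qed
  show ?thesis
  proof (rule that[OF B(1)])
    show "E b \<in> left_invariant_fields A" for b
      unfolding E_def by (rule left_extension_invariant[OF T])
    show "g p (E a p) (E b p) = (if a = b then 1 else 0)" if "a \<in> B" "b \<in> B" for a b p
      using g_push[OF T T, of p a b] B(2)[OF that] by (simp add: Ep \<beta>_def)
    fix p u assume u: "u \<in> tangent_space A p"
    let ?u0 = "left_push (- p) u"
    have u0: "?u0 \<in> tangent_space A 0" by (rule left_push_back_tangent[OF u])
    have pushed_back: "left_push p ?u0 = u" by (simp add: left_push_left_push)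
    obtain v where v: "?u0 = ?v v" using u0 by (auto simp: tangent_space_eq[OF c])
    have "?u0 = ?v (\<Sum>b\<in>B. \<beta> v b *\<^sub>R b)" unfolding v using exp[of v] by simp
    also have "\<dots> = (\<lambda>f. \<Sum>b\<in>B. g 0 ?u0 (?v b) * ?v b f)" by (simp add: vsum[OF B(1)] \<beta>_def v)
    finally have *: "?u0 f = (\<Sum>b\<in>B. g 0 ?u0 (?v b) * ?v b f)" for f by (rule fun_cong)
    have gE: "g p u (E b p) = g 0 ?u0 (?v b)" for b
      using g_push[OF u0 T, of p b] by (simp only: pushed_back Ep add_0_right)
    show "u = (\<lambda>f. \<Sum>b\<in>B. g p u (E b p) * E b p f)"
    proof
      fix f
      have "u f = left_push p ?u0 f" by (simp only: pushed_back)
      also have "\<dots> = ?u0 (\<lambda>x. f (p + x))" by (simp only: left_push_def[of p])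
      also have "\<dots> = (\<Sum>b\<in>B. g 0 ?u0 (?v b) * ?v b (\<lambda>x. f (p + x)))" by (rule *)
      finally show "u f = (\<Sum>b\<in>B. g p u (E b p) * E b p f)"
        unfolding gE by (simp only: Ep left_push_def[of p])
    qed
  qed
qed

section \<open>Uniqueness of the Levi-Civita connection\<close>

text \<open>
  The difference of two such connections, paired with a third field, is symmetric in its first two
  arguments because both have the same torsion, and skew in its last two because both preserve the
  metric. Such a trilinear form vanishes.
\<close>

lemma levi_civita_unique:
  assumes D: "is_levi_civita A g D" and D': "is_levi_civita A g D'"
    and X: "smooth_vector_field A X" and Y: "smooth_vector_field A Y"
  shows "D X Y = D' X Y"
proof -
  have smooth: "smooth_vector_field A (D X Y)" "smooth_vector_field A (D' X Y)"
    if "smooth_vector_field A X" "smooth_vector_field A Y" for X Y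
    using D D' that by (auto simp: is_levi_civita_def affine_connection_def)
  have T: "D X Y p \<in> tangent_space A p" "D' X Y p \<in> tangent_space A p"
    if "smooth_vector_field A X" "smooth_vector_field A Y" for X Y p
    using smooth[OF that] by (auto intro: field_tangent)
  define S where "S p X Y Z = g p (D X Y p) (Z p) - g p (D' X Y p) (Z p)" for p X Y Z
  have S_sym: "S p X Y Z = S p Y X Z"
    if v: "smooth_vector_field A X" "smooth_vector_field A Y" "smooth_vector_field A Z" for p X Y Z
  proof -
    note Tp = T[OF v(1,2), of p] T[OF v(2,1), of p] field_tangent[OF v(3), of p]
    have "field_diff (D X Y) (D Y X) = field_diff (D' X Y) (D' Y X)"
      using D D' v by (simp add: is_levi_civita_def)
    then have "(\<lambda>f. D X Y p f - D Y X p f) = (\<lambda>f. D' X Y p f - D' Y X p f)"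
      by (auto simp: field_diff_def fun_eq_iff)
    then have "g p (\<lambda>f. D X Y p f - D Y X p f) (Z p) = g p (\<lambda>f. D' X Y p f - D' Y X p f) (Z p)"
      by simp
    then show ?thesis using Tp by (simp add: S_def g_diff)
  qed
  have S_skew: "S p X Y Z = - S p X Z Y"
    if v: "smooth_vector_field A X" "smooth_vector_field A Y" "smooth_vector_field A Z" for p X Y Z
  proof -
    have "X p (\<lambda>q. g q (Y q) (Z q)) = g p (D X Y p) (Z p) + g p (Y p) (D X Z p)"
      "X p (\<lambda>q. g q (Y q) (Z q)) = g p (D' X Y p) (Z p) + g p (Y p) (D' X Z p)"
      using D D' v by (auto simp: is_levi_civita_def)
    moreover have "g p (Y p) (D X Z p) = g p (D X Z p) (Y p)" "g p (Y p) (D' X Z p) = g p (D' X Z p) (Y p)"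
      using T v field_tangent by (auto intro!: g_sym)
    ultimately show ?thesis by (simp add: S_def)
  qed
  \<comment> \<open>Applying the two symmetries alternately, three times each, leads back to \<open>S p X Y Z\<close> with a
      negative sign.\<close>
  have S_zero: "S p X Y Z = 0" if Z: "smooth_vector_field A Z" for p Z
    using S_sym[OF X Y Z, of p] S_skew[OF Y X Z, of p] S_sym[OF Y Z X, of p]
      S_skew[OF Z Y X, of p] S_sym[OF Z X Y, of p] S_skew[OF X Z Y, of p] by simp
  obtain B :: "'e set" and E where "finite B" and E: "\<And>b. E b \<in> left_invariant_fields A"
    "\<And>p u. u \<in> tangent_space A p \<Longrightarrow> u = (\<lambda>f. \<Sum>b\<in>B. g p u (E b p) * E b p f)"
    by (rule orthonormal_frame_exists) (rule that)
  have "D X Y p = D' X Y p" for p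
  proof -
    have "g p (D X Y p) (E b p) = g p (D' X Y p) (E b p)" for b
      using S_zero[of "E b" p] E(1)[of b] by (simp add: left_invariant_fields_def S_def)
    note coefficients = this
    have "D X Y p = (\<lambda>f. \<Sum>b\<in>B. g p (D X Y p) (E b p) * E b p f)" by (rule E(2)[OF T(1)[OF X Y]])
    also have "\<dots> = (\<lambda>f. \<Sum>b\<in>B. g p (D' X Y p) (E b p) * E b p f)" by (simp only: coefficients)
    also have "\<dots> = D' X Y p" by (rule E(2)[OF T(2)[OF X Y], symmetric])
    finally show ?thesis .
  qed
  then show ?thesis by blast
qed

end

section \<open>The connection of a commuting orthonormal frame\<close>

text \<open>
  The frame fields play the role of the coordinate fields of a Euclidean space, but they are
  defined globally even where no global coordinates exist, as on a torus.
\<close>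

locale flat_frame = left_invariant_metric A g
  for A :: "('g::{topological_group_add, t2_space, second_countable_topology},
               'e::euclidean_space) chart set" and g +
  fixes B :: "'i set" and E :: "'i \<Rightarrow> 'g vector_field"
  assumes finite_B: "finite B"
    and frame_smooth: "smooth_vector_field A (E b)"
    and frame_orthonormal: "a \<in> B \<Longrightarrow> b \<in> B \<Longrightarrow> g p (E a p) (E b p) = (if a = b then 1 else 0)"
    and frame_expansion: "u \<in> tangent_space A p \<Longrightarrow> u = (\<lambda>f. \<Sum>b\<in>B. g p u (E b p) * E b p f)"
    and frame_commutes: "field_bracket A (E a) (E b) = (\<lambda>p f. 0)"
begin

definition component :: "'i \<Rightarrow> 'g vector_field \<Rightarrow> 'g \<Rightarrow> real" where
  "component b X = (\<lambda>q. g q (X q) (E b q))"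

text \<open>The connection for which the frame fields are parallel.\<close>

definition parallel_connection :: "'g connection" where
  "parallel_connection X Y = (\<lambda>p f. \<Sum>b\<in>B. X p (component b Y) * E b p f)"

text \<open>
  Taking components as inner products with the frame makes their smoothness part of the smoothness
  of the metric.
\<close>

lemma component_smooth: "smooth_vector_field A X \<Longrightarrow> smooth_fun_on A UNIV (component b X)"
  unfolding component_def by (intro g_smooth frame_smooth)

lemma component_smooth_near: "smooth_vector_field A X \<Longrightarrow> smooth_near A p (component b X)"
  using component_smooth smooth_nearI by blast

lemma frame_tangent: "E b p \<in> tangent_space A p"
  by (rule field_tangent[OF frame_smooth])

lemma field_expansion: "smooth_vector_field A X \<Longrightarrow> X p f = (\<Sum>b\<in>B. component b X p * E b p f)"
  using fun_cong[OF frame_expansion[OF field_tangent]] by (simp add: component_def)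

lemma component_sum:
  assumes "a \<in> B"
  shows "g p (\<lambda>f. \<Sum>b\<in>B. r b * E b p f) (E a p) = r a"
proof -
  have "g p (\<lambda>f. \<Sum>b\<in>B. r b * E b p f) (E a p) = (\<Sum>b\<in>B. r b * g p (E b p) (E a p))"
    by (rule g_sum) (rule frame_tangent)+
  also have "\<dots> = (\<Sum>b\<in>B. if b = a then r b else 0)"
    using assms by (intro sum.cong) (auto simp: frame_orthonormal)
  finally show ?thesis using assms finite_B by simp
qed

lemma component_parallel_connection:
  "b \<in> B \<Longrightarrow> component b (parallel_connection X Y) = (\<lambda>q. X q (component b Y))"
  unfolding component_def[of b "parallel_connection X Y"]
  by (simp add: parallel_connection_def component_sum)

lemma parallel_connection_smooth:
  assumes "smooth_vector_field A X" "smooth_vector_field A Y"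
  shows "smooth_vector_field A (parallel_connection X Y)"
  unfolding parallel_connection_def
  by (rule smooth_field_sum[OF frame_smooth field_smooth[OF assms(1) component_smooth[OF assms(2)]]])

lemma affine_parallel_connection: "affine_connection A parallel_connection"
  unfolding affine_connection_def
proof (intro conjI allI impI)
  fix X Y Z assume X: "smooth_vector_field A X" and Y: "smooth_vector_field A Y" and Z: "smooth_vector_field A Z"
  show "parallel_connection (field_add X Y) Z = field_add (parallel_connection X Z) (parallel_connection Y Z)"
    by (simp add: parallel_connection_def field_add_def distrib_right sum.distrib)
  have "component b (field_add Y Z) = (\<lambda>q. component b Y q + component b Z q)" for b
    by (simp add: component_def field_add_def g_add field_tangent Y Z frame_tangent)
  then have "X p (component b (field_add Y Z)) = X p (component b Y) + X p (component b Z)" for b p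
    using tangent_add[OF field_tangent[OF X] component_smooth_near[OF Y] component_smooth_near[OF Z]] by simp
  then show "parallel_connection X (field_add Y Z) = field_add (parallel_connection X Y) (parallel_connection X Z)"
    by (simp add: parallel_connection_def field_add_def distrib_right sum.distrib)
next
  fix h X Y assume h: "smooth_fun_on A UNIV h" and X: "smooth_vector_field A X" and Y: "smooth_vector_field A Y"
  show "parallel_connection (field_mult h X) Y = field_mult h (parallel_connection X Y)"
    by (simp add: parallel_connection_def field_mult_def sum_distrib_left mult.assoc)
  have "component b (field_mult h Y) = (\<lambda>q. h q * component b Y q)" for b
    by (simp add: component_def field_mult_def g_scale field_tangent Y frame_tangent)
  then have "X p (component b (field_mult h Y)) = X p h * component b Y p + h p * X p (component b Y)" for b p
    using tangent_mult[OF field_tangent[OF X] smooth_nearI[OF h] component_smooth_near[OF Y]] by simp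
  then show "parallel_connection X (field_mult h Y)
      = field_add (field_mult (\<lambda>p. X p h) Y) (field_mult h (parallel_connection X Y))"
    by (simp add: parallel_connection_def field_mult_def field_add_def field_expansion[OF Y]
        distrib_right sum.distrib sum_distrib_left mult.assoc)
qed (rule parallel_connection_smooth)

text \<open>
  Expanding \<open>Y = \<Sum>\<^sub>b y\<^sub>b E\<^sub>b\<close> gives \<open>X(Y f) = (D X Y) f + \<Sum>\<^sub>a\<^sub>b y\<^sub>b x\<^sub>a E\<^sub>a(E\<^sub>b f)\<close>. The double sum is
  symmetric in \<open>X\<close> and \<open>Y\<close> since the frame commutes, so it drops out of the bracket.
\<close>

lemma parallel_connection_torsion_free:
  assumes X: "smooth_vector_field A X" and Y: "smooth_vector_field A Y"
  shows "field_diff (parallel_connection X Y) (parallel_connection Y X) = field_bracket A X Y"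
proof (intro ext)
  fix p f
  show "field_diff (parallel_connection X Y) (parallel_connection Y X) p f = field_bracket A X Y p f"
  proof (cases "smooth_near A p f")
    case False
    then show ?thesis
      by (simp add: field_diff_def parallel_connection_def field_bracket_def
          tangent_not_smooth[OF frame_tangent])
  next
    case True
    have iterate: "V p (\<lambda>q. Z q f) = parallel_connection V Z p f +
        (\<Sum>b\<in>B. \<Sum>a\<in>B. component b Z p * (component a V p * E a p (\<lambda>q. E b q f)))"
      if V: "smooth_vector_field A V" and Z: "smooth_vector_field A Z" for V Z
    proof -
      have Ef: "smooth_near A p (\<lambda>q. E b q f)" for b by (rule field_smooth_near[OF frame_smooth True])
      note Zb = component_smooth_near[OF Z]
      have "V p (\<lambda>q. Z q f) = V p (\<lambda>q. \<Sum>b\<in>B. component b Z q * E b q f)"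
        using field_expansion[OF Z] by simp
      also have "\<dots> = (\<Sum>b\<in>B. V p (\<lambda>q. component b Z q * E b q f))"
        by (rule tangent_sum_fun[OF field_tangent[OF V] smooth_near_mult[OF Zb Ef]])
      also have "\<dots> = (\<Sum>b\<in>B. V p (component b Z) * E b p f + component b Z p * V p (\<lambda>q. E b q f))"
        by (simp add: tangent_mult[OF field_tangent[OF V] Zb Ef])
      also have "\<dots> = parallel_connection V Z p f + (\<Sum>b\<in>B. component b Z p * V p (\<lambda>q. E b q f))"
        by (simp add: sum.distrib parallel_connection_def)
      finally show ?thesis by (simp add: field_expansion[OF V, of p "\<lambda>q. E _ q f"] sum_distrib_left)
    qed
    have comm: "E a p (\<lambda>q. E b q f) = E b p (\<lambda>q. E a q f)" for a b
      using fun_cong[OF fun_cong[OF frame_commutes[of a b], of p], of f] True by (simp add: field_bracket_def)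
    have "(\<Sum>b\<in>B. \<Sum>a\<in>B. component b Y p * (component a X p * E a p (\<lambda>q. E b q f)))
        = (\<Sum>b\<in>B. \<Sum>a\<in>B. component b X p * (component a Y p * E a p (\<lambda>q. E b q f)))"
      by (subst sum.swap) (simp add: comm mult.left_commute)
    then show ?thesis
      using True by (simp add: field_diff_def field_bracket_def iterate[OF X Y] iterate[OF Y X])
  qed
qed

text \<open>
  In an orthonormal frame \<open>g(Y, Z) = \<Sum>\<^sub>b y\<^sub>b z\<^sub>b\<close>, so the claim is the Leibniz rule for the
  components.
\<close>

lemma parallel_connection_metric:
  assumes X: "smooth_vector_field A X" and Y: "smooth_vector_field A Y" and Z: "smooth_vector_field A Z"
  shows "X p (\<lambda>q. g q (Y q) (Z q)) =
    g p (parallel_connection X Y p) (Z p) + g p (Y p) (parallel_connection X Z p)"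
proof -
  have expand: "g q (\<lambda>f. \<Sum>b\<in>B. r b * E b q f) (V q) = (\<Sum>b\<in>B. r b * component b V q)"
    if "smooth_vector_field A V" for r q V
    using g_sum[OF field_tangent[OF that] frame_tangent]
      g_sym[OF frame_tangent field_tangent[OF that]] by (simp add: component_def)
  have "g q (Y q) (Z q) = (\<Sum>b\<in>B. component b Y q * component b Z q)" for q
    using expand[OF Z, of q "\<lambda>b. component b Y q"] by (simp flip: field_expansion[OF Y])
  then have "X p (\<lambda>q. g q (Y q) (Z q)) = X p (\<lambda>q. \<Sum>b\<in>B. component b Y q * component b Z q)"
    by simp
  also have "\<dots> = (\<Sum>b\<in>B. X p (\<lambda>q. component b Y q * component b Z q))"
    by (rule tangent_sum_fun[OF field_tangent[OF X]
          smooth_near_mult[OF component_smooth_near[OF Y] component_smooth_near[OF Z]]])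
  also have "\<dots> = (\<Sum>b\<in>B. X p (component b Y) * component b Z p) + (\<Sum>b\<in>B. X p (component b Z) * component b Y p)"
    by (simp add: tangent_mult[OF field_tangent[OF X] component_smooth_near[OF Y] component_smooth_near[OF Z]]
        sum.distrib mult.commute)
  also have "(\<Sum>b\<in>B. X p (component b Y) * component b Z p) = g p (parallel_connection X Y p) (Z p)"
    unfolding parallel_connection_def by (rule expand[OF Z, symmetric])
  also have "(\<Sum>b\<in>B. X p (component b Z) * component b Y p) = g p (parallel_connection X Z p) (Y p)"
    unfolding parallel_connection_def by (rule expand[OF Y, symmetric])
  also have "\<dots> = g p (Y p) (parallel_connection X Z p)"
    by (rule g_sym[OF field_tangent[OF parallel_connection_smooth[OF X Z]] field_tangent[OF Y]])
  finally show ?thesis .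
qed

lemma levi_civita_parallel_connection: "is_levi_civita A g parallel_connection"
  unfolding is_levi_civita_def
  using affine_parallel_connection parallel_connection_torsion_free parallel_connection_metric by blast

lemma is_levi_civita_levi_civita: "is_levi_civita A g (levi_civita A g)"
  unfolding levi_civita_def by (rule someI[of "is_levi_civita A g", OF levi_civita_parallel_connection])

lemma levi_civita_eq:
  "smooth_vector_field A X \<Longrightarrow> smooth_vector_field A Y \<Longrightarrow> levi_civita A g X Y = parallel_connection X Y"
  by (rule levi_civita_unique[OF is_levi_civita_levi_civita levi_civita_parallel_connection])

text \<open>
  Covariant derivatives act on components as derivations, so the components of the curvature are
  \<open>X(Y z) - Y(X z) - [X, Y] z\<close>, which is 0 by definition of the bracket.
\<close>

lemma curvature_zero:
  assumes X: "smooth_vector_field A X" and Y: "smooth_vector_field A Y" and Z: "smooth_vector_field A Z"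
  shows "curvature A (levi_civita A g) X Y Z = (\<lambda>p f. 0)"
proof (intro ext)
  fix p f
  have twice: "levi_civita A g V (levi_civita A g W Z) p f = (\<Sum>b\<in>B. V p (\<lambda>q. W q (component b Z)) * E b p f)"
    if V: "smooth_vector_field A V" and W: "smooth_vector_field A W" for V W
  proof -
    have "levi_civita A g V (levi_civita A g W Z) = parallel_connection V (parallel_connection W Z)"
      by (simp only: levi_civita_eq V W Z parallel_connection_smooth)
    then show ?thesis
      by (simp add: parallel_connection_def[of V] component_parallel_connection)
  qed
  have "curvature A (levi_civita A g) X Y Z p f =
     (\<Sum>b\<in>B. X p (\<lambda>q. Y q (component b Z)) * E b p f) - (\<Sum>b\<in>B. Y p (\<lambda>q. X q (component b Z)) * E b p f)
      - (\<Sum>b\<in>B. field_bracket A X Y p (component b Z) * E b p f)"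
    by (simp only: curvature_def field_diff_def twice[OF X Y] twice[OF Y X]
        levi_civita_eq[OF smooth_field_bracket[OF X Y] Z] parallel_connection_def[of _ Z])
  also have "\<dots> = 0"
    by (simp add: field_bracket_def component_smooth_near[OF Z] sum_subtractf left_diff_distrib)
  finally show "curvature A (levi_civita A g) X Y Z p f = 0" .
qed

text \<open>
  The Ricci curvature is a trace over a chosen orthonormal basis. The frame shows that one exists,
  so that the chosen basis consists of tangent vectors.
\<close>

lemma orthonormal_basis_frame: "orthonormal_basis A g p ((\<lambda>b. E b p) ` B)"
proof -
  have inj: "inj_on (\<lambda>b. E b p) B"
  proof (rule inj_onI)
    fix a b assume ab: "a \<in> B" "b \<in> B" "E a p = E b p"
    then show "a = b"
      using frame_orthonormal[OF ab(1,2), of p] frame_orthonormal[OF ab(2,2), of p] by (auto split: if_splits)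
  qed
  have "u = (\<lambda>f. \<Sum>b\<in>(\<lambda>b. E b p) ` B. g p u b * b f)" if "u \<in> tangent_space A p" for u
    using frame_expansion[OF that] by (simp add: sum.reindex[OF inj])
  then show ?thesis
    using frame_orthonormal frame_tangent finite_B inj
    by (auto simp: orthonormal_basis_def dest: inj_onD[OF inj])
qed

lemma ricci_zero:
  assumes u: "u \<in> tangent_space A p" and v: "v \<in> tangent_space A p"
  shows "ricci A g p u v = 0"
proof -
  have extend: "smooth_vector_field A (extend_vector A p w)" if "w \<in> tangent_space A p" for w
  proof -
    have "smooth_vector_field A (left_extension (left_push (- p) w))"
      by (rule smooth_left_extension[OF left_push_back_tangent[OF that]])
    moreover have "left_extension (left_push (- p) w) p = w"
      by (simp add: left_extension_def left_push_left_push)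
    ultimately have "\<exists>X. smooth_vector_field A X \<and> X p = w" by blast
    from someI_ex[OF this] show ?thesis unfolding extend_vector_def by blast
  qed
  have "orthonormal_basis A g p (SOME C. orthonormal_basis A g p C)"
    by (rule someI[of "orthonormal_basis A g p", OF orthonormal_basis_frame])
  then have "(SOME C. orthonormal_basis A g p C) \<subseteq> tangent_space A p"
    unfolding orthonormal_basis_def by blast
  then show ?thesis
    unfolding ricci_def curvature_at_def
    by (intro sum.neutral ballI) (simp add: curvature_zero extend u v g_zero subset_iff)
qed

end

section \<open>Prescribing the Ricci curvature on abelian groups\<close>

theorem theorem3:
  fixes A :: "('g::{topological_group_add, t2_space, second_countable_topology},
               'e::euclidean_space) chart set"
    and T :: "'g tensor2"
  assumes "lie_group A"
    and "connected (UNIV :: 'g set)"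
    and "has_lie_algebra A bracket_5A1"
    and "symmetric_tensor_field2 A T"
    and "left_invariant2 A T"
  shows "(\<exists>(g :: 'g tensor2) (t :: real).
            riemannian_metric A g \<and> left_invariant2 A g \<and> t \<noteq> 0 \<and>
            (\<forall>p. \<forall>u\<in>tangent_space A p. \<forall>v\<in>tangent_space A p. ricci A g p u v = t\<^sup>2 * T p u v))
         \<longleftrightarrow> (\<forall>p. \<forall>u\<in>tangent_space A p. \<forall>v\<in>tangent_space A p. T p u v = 0)"
proof -
  interpret lie_group_manifold A by unfold_locales (rule assms(1))
  have flat: "ricci A g p u v = 0"
    if g: "riemannian_metric A g" "left_invariant2 A g"
      and uv: "u \<in> tangent_space A p" "v \<in> tangent_space A p" for g p u v
  proof -
    interpret left_invariant_metric A g by unfold_locales (rule g)+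
    obtain B :: "'e set" and E where B: "finite B" and E: "\<And>b. E b \<in> left_invariant_fields A"
      "\<And>a b p. a \<in> B \<Longrightarrow> b \<in> B \<Longrightarrow> g p (E a p) (E b p) = (if a = b then 1 else 0)"
      "\<And>p u. u \<in> tangent_space A p \<Longrightarrow> u = (\<lambda>f. \<Sum>b\<in>B. g p u (E b p) * E b p f)"
      by (rule orthonormal_frame_exists) (rule that)
    interpret flat_frame A g B E
    proof unfold_locales
      show "smooth_vector_field A (E b)" for b using E(1) by (simp add: left_invariant_fields_def)
      show "field_bracket A (E a) (E b) = (\<lambda>p f. 0)" for a b
        by (rule field_bracket_left_invariant_eq_0[OF assms(3) _ E(1) E(1)]) (simp add: bracket_5A1_def)
    qed (fact B E)+
    show ?thesis by (rule ricci_zero[OF uv])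
  qed
  show ?thesis
  proof
    assume "\<exists>(g :: 'g tensor2) (t :: real). riemannian_metric A g \<and> left_invariant2 A g \<and> t \<noteq> 0 \<and>
      (\<forall>p. \<forall>u\<in>tangent_space A p. \<forall>v\<in>tangent_space A p. ricci A g p u v = t\<^sup>2 * T p u v)"
    then show "\<forall>p. \<forall>u\<in>tangent_space A p. \<forall>v\<in>tangent_space A p. T p u v = 0"
      using flat by fastforce
  next
    assume T: "\<forall>p. \<forall>u\<in>tangent_space A p. \<forall>v\<in>tangent_space A p. T p u v = 0"
    obtain g where "riemannian_metric A g" "left_invariant2 A g"
      using left_invariant_metric_exists by blast
    with flat T show "\<exists>(g :: 'g tensor2) (t :: real). riemannian_metric A g \<and> left_invariant2 A g \<and> t \<noteq> 0 \<and>
      (\<forall>p. \<forall>u\<in>tangent_space A p. \<forall>v\<in>tangent_space A p. ricci A g p u v = t\<^sup>2 * T p u v)"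
      by (intro exI[of _ g] exI[of _ "1::real"]) simp
  qed
qed

end
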